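(* Let $T[0..n-1]$ be a text of length $n$ over an alphabet of size $\sigma$ whose Burrows-Wheeler Transform consists of $r$ runs. Then there is a data structure (a run-length compressed suffix array for $T$) that occupies $O\left(r\log(n/r)+r\log\sigma+\sigma\right)$ bits and supports the following query: given a character $a$ of the alphabet and the suffix-array interval for a pattern $P$ with respect to $T$, it returns the suffix-array interval for $aP$ with respect to $T$ in $O(\log r_a)$ time, where $r_a$ is the number of runs of copies of $a$ in the Burrows-Wheeler Transform of $T$. The constants hidden in the $O$-notation are absolute.
   Context: Model: the word RAM with words of $\Theta(\log n)$ bits, where text positions and characters each fit in $O(1)$ words; space is counted in bits. The text $T[0..n-1]$ is over the totally ordered alphabet $\{0,\ldots,\sigma-1\}$ and ends with a terminator symbol that occurs nowhere else in $T$ and is smaller than all other characters of $T$. The suffix array $\mathrm{SA}[0..n-1]$ of $T$ is the permutation of $\{0,\ldots,n-1\}$ listing the starting positions of the suffixes of $T$ in lexicographic order of the suffixes. The Burrows-Wheeler Transform (BWT) of $T$ is the string $L[0..n-1]$ with $L[i]=T[(\mathrm{SA}[i]-1)\bmod n]$. A run is a maximal block of consecutive equal characters in $L$; $r$ is the total number of runs in $L$, and $r_a$ is the number of runs consisting of copies of $a$. The suffix-array (SA) interval for a string $P$ is the set of indices $i$ such that the suffix $T[\mathrm{SA}[i]..n-1]$ has $P$ as a prefix; it is a (possibly empty) interval $[s..e]$ and is given and returned by its two endpoints (or as "empty"). $aP$ denotes the character $a$ followed by $P$. Convention: a time bound $O(\log r_a)$ is read as $O(1)$ when $r_a\le 1$,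 i.e. as $O(1+\log(\max(r_a,1)))$. *)

theory Defs
  imports Complex_Main "HOL-Library.List_Lexorder" "HOL-Library.Sublist"
begin

section \<open>Texts, suffix arrays and the Burrows-Wheeler transform\<close>

text \<open>The condition on \<^term>\<open>last T\<close> says both that the terminator is smaller than every other
  character and that it occurs nowhere else.\<close>

definition valid_text :: "nat \<Rightarrow> nat list \<Rightarrow> bool" where
  "valid_text \<sigma> T \<longleftrightarrow> T \<noteq> [] \<and> set T \<subseteq> {..<\<sigma>} \<and> (\<forall>x \<in> set (butlast T). last T < x)"

text \<open>The order on \<^typ>\<open>nat list\<close> is the lexicographic one, in which proper prefixes come first.
  The suffixes are pairwise distinct, so sorting them determines the suffix array.\<close>

definition suffix_array :: "nat list \<Rightarrow> nat list" where
  "suffix_array T = sort_key (\<lambda>j. drop j T) [0..<length T]"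

definition bwt :: "nat list \<Rightarrow> nat list" where
  "bwt T = map (\<lambda>j. T ! nat ((int j - 1) mod int (length T))) (suffix_array T)"

definition runs :: "nat list \<Rightarrow> (nat \<times> nat) set" where
  "runs L = {(i, j). i \<le> j \<and> j < length L \<and> (\<forall>k \<in> {i..j}. L ! k = L ! i) \<and>
     (0 < i \<longrightarrow> L ! (i - 1) \<noteq> L ! i) \<and> (j + 1 < length L \<longrightarrow> L ! (j + 1) \<noteq> L ! j)}"

definition num_runs :: "nat list \<Rightarrow> nat" where
  "num_runs L = card (runs L)"

definition num_runs_of :: "nat \<Rightarrow> nat list \<Rightarrow> nat" where
  "num_runs_of a L = card {(i, j) \<in> runs L. L ! i = a}"

definition sa_indices :: "nat list \<Rightarrow> nat list \<Rightarrow> nat set" where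
  "sa_indices T P = {i. i < length T \<and> prefix P (drop (suffix_array T ! i) T)}"

definition sa_interval :: "nat list \<Rightarrow> nat list \<Rightarrow> (nat \<times> nat) option" where
  "sa_interval T P =
    (if sa_indices T P = {} then None else Some (Min (sa_indices T P), Max (sa_indices T P)))"

lemma prefix_convex:
  fixes xs ys zs :: "nat list"
  assumes "xs \<le> ys" "ys \<le> zs" "prefix P xs" "prefix P zs"
  shows "prefix P ys"
  using assms
proof (induction P arbitrary: xs ys zs)
  case (Cons p P)
  obtain xs' zs' where xz: "xs = p # xs'" "zs = p # zs'" "prefix P xs'" "prefix P zs'"
    using Cons.prems(3,4) by (auto simp: prefix_def)
  obtain y ys' where y: "ys = y # ys'"
    using Cons.prems(1) xz(1) by (cases ys) simp_all
  have "y = p" "xs' \<le> ys'" "ys' \<le> zs'"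
    using Cons.prems(1,2) xz(1,2) y by auto
  with Cons.IH[OF _ _ xz(3,4)] y show ?case by simp
qed simp

text \<open>The two endpoints describe the whole index set.\<close>

lemma sa_indices_eq_interval:
  assumes "sa_interval T P = Some (s, e)"
  shows "sa_indices T P = {s..e}"
proof -
  let ?I = "sa_indices T P"
  have fin: "finite ?I" by (simp add: sa_indices_def)
  have ne: "?I \<noteq> {}" and s: "s = Min ?I" and e: "e = Max ?I"
    using assms by (auto simp: sa_interval_def split: if_splits)
  have mem: "s \<in> ?I" "e \<in> ?I"
    unfolding s e by (rule Min_in[OF fin ne], rule Max_in[OF fin ne])
  have len: "length (suffix_array T) = length T" by (simp add: suffix_array_def)
  have sorted: "sorted (map (\<lambda>j. drop j T) (suffix_array T))"
    by (simp add: suffix_array_def)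
  have mono: "drop (suffix_array T ! i) T \<le> drop (suffix_array T ! j) T"
    if "i \<le> j" "j < length T" for i j
    using sorted_nth_mono[OF sorted, of i j] that len by simp
  have "i \<in> ?I" if "s \<le> i" "i \<le> e" for i
  proof -
    have "i < length T" using mem(2) that(2) by (simp add: sa_indices_def)
    moreover have "prefix P (drop (suffix_array T ! i) T)"
      by (rule prefix_convex[OF mono[of s i] mono[of i e]])
        (use mem that \<open>i < length T\<close> in \<open>simp_all add: sa_indices_def\<close>)
    ultimately show ?thesis by (simp add: sa_indices_def)
  qed
  moreover have "s \<le> i \<and> i \<le> e" if "i \<in> ?I" for i
    unfolding s e by (intro conjI Min_le[OF fin that] Max_ge[OF fin that])
  ultimately show ?thesis by (intro set_eqI) (metis atLeastAtMost_iff)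
qed

section \<open>Word RAM\<close>

text \<open>Memory is a finite list of \<open>w\<close>-bit cells; a program has no storage besides these cells and
  the finitely many registers that it mentions. Registers hold integers of \<open>k\<close> words, for a
  constant \<open>k\<close>, and an operation on them takes unit time: this is the usual convention that
  arithmetic on integers of \<open>O(1)\<close> words takes \<open>O(1)\<close> time, with each operation on \<open>k\<close>-word
  integers standing for a constant number of one-word operations. An access outside the memory
  has no transition, so that the cells of the list are all the space that can be used.\<close>

type_synonym reg = nat

datatype binop = Add | Sub | Mult | Divide | Modulo | BitAnd | BitOr | BitXor
  | ShiftLeft | ShiftRight | Less | Equal

datatype com =
    Skip
  | Const reg nat
  | Op binop reg reg reg
  | Load reg reg
  | Store reg reg
  | Seq com com
  | IfNZ reg com com
  | WhileNZ reg com

text \<open>The parameter \<open>b\<close> is the number of bits of a register; subtraction is modulo \<open>2 ^ b\<close>.\<close>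

fun apply_op :: "nat \<Rightarrow> binop \<Rightarrow> nat \<Rightarrow> nat \<Rightarrow> nat" where
  "apply_op b Add x y = (x + y) mod 2 ^ b"
| "apply_op b Sub x y = (x + (2 ^ b - y)) mod 2 ^ b"
| "apply_op b Mult x y = (x * y) mod 2 ^ b"
| "apply_op b Divide x y = x div y"
| "apply_op b Modulo x y = x mod y"
| "apply_op b BitAnd x y = Bit_Operations.and x y"
| "apply_op b BitOr x y = Bit_Operations.or x y"
| "apply_op b BitXor x y = Bit_Operations.xor x y"
| "apply_op b ShiftLeft x y = push_bit y x mod 2 ^ b"
| "apply_op b ShiftRight x y = drop_bit y x"
| "apply_op b Less x y = (if x < y then 1 else 0)"
| "apply_op b Equal x y = (if x = y then 1 else 0)"

type_synonym state = "nat list \<times> (reg \<Rightarrow> nat)"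

text \<open>\<open>exec w k c s t s'\<close>: started in state \<open>s\<close>, the command \<open>c\<close> halts in \<open>s'\<close> after \<open>t\<close> steps.\<close>

inductive exec :: "nat \<Rightarrow> nat \<Rightarrow> com \<Rightarrow> state \<Rightarrow> nat \<Rightarrow> state \<Rightarrow> bool" for w k :: nat where
  Skip: "exec w k Skip s 1 s"
| Const: "exec w k (Const x v) (M, R) 1 (M, R(x := v mod 2 ^ (k * w)))"
| Op: "exec w k (Op f x y z) (M, R) 1 (M, R(x := apply_op (k * w) f (R y) (R z)))"
| Load: "R y < length M \<Longrightarrow> exec w k (Load x y) (M, R) 1 (M, R(x := M ! R y))"
| Store: "R x < length M \<Longrightarrow> exec w k (Store x y) (M, R) 1 (M[R x := R y mod 2 ^ w], R)"
| Seq: "exec w k c1 s t1 s' \<Longrightarrow> exec w k c2 s' t2 s'' \<Longrightarrow> exec w k (Seq c1 c2) s (t1 + t2) s''"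
| IfNonzero: "snd s x \<noteq> 0 \<Longrightarrow> exec w k c1 s t s' \<Longrightarrow> exec w k (IfNZ x c1 c2) s (t + 1) s'"
| IfZero: "snd s x = 0 \<Longrightarrow> exec w k c2 s t s' \<Longrightarrow> exec w k (IfNZ x c1 c2) s (t + 1) s'"
| WhileZero: "snd s x = 0 \<Longrightarrow> exec w k (WhileNZ x c) s 1 s"
| WhileNonzero: "snd s x \<noteq> 0 \<Longrightarrow> exec w k c s t1 s' \<Longrightarrow> exec w k (WhileNZ x c) s' t2 s'' \<Longrightarrow>
    exec w k (WhileNZ x c) s (t1 + t2 + 1) s''"

inductive_cases exec_SeqE: "exec w k (Seq c1 c2) s t s'"
inductive_cases exec_IfE: "exec w k (IfNZ x c1 c2) s t s'"
inductive_cases exec_WhileE: "exec w k (WhileNZ x c) s t s'"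

lemma exec_deterministic:
  "exec w k c s t s' \<Longrightarrow> exec w k c s u s'' \<Longrightarrow> u = t \<and> s'' = s'"
proof (induction arbitrary: u s'' rule: exec.induct)
  case (Skip s)
  then show ?case by (cases rule: exec.cases) simp
next
  case (Const x v M R)
  then show ?case by (cases rule: exec.cases) simp
next
  case (Op f x y z M R)
  then show ?case by (cases rule: exec.cases) simp
next
  case (Load R y M x)
  from Load.prems show ?case by (cases rule: exec.cases) simp
next
  case (Store R x M y)
  from Store.prems show ?case by (cases rule: exec.cases) simp
next
  case (Seq c1 s t1 s1 c2 t2 s2)
  from Seq.prems show ?case
    by (rule exec_SeqE) (metis Seq.IH)
next
  case (IfNonzero s x c1 t s' c2)
  from IfNonzero.prems show ?case
    by (rule exec_IfE) (use IfNonzero.hyps in simp_all, metis IfNonzero.IH)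
next
  case (IfZero s x c2 t s' c1)
  from IfZero.prems show ?case
    by (rule exec_IfE) (use IfZero.hyps in simp_all, metis IfZero.IH)
next
  case (WhileZero s x c)
  from WhileZero.prems show ?case
    by (rule exec_WhileE) (use WhileZero.hyps in simp_all)
next
  case (WhileNonzero s x c t1 s1 t2 s2)
  from WhileNonzero.prems show ?case
    by (rule exec_WhileE) (use WhileNonzero.hyps in simp_all, metis WhileNonzero.IH)
qed

text \<open>Calling convention: register 0 holds the character. A flag in register 1 tells whether the
  interval is nonempty, in which case registers 2 and 3 hold its endpoints; on halting, registers
  1 to 3 describe the answer in the same way.\<close>

definition query_input :: "nat \<Rightarrow> (nat \<times> nat) option \<Rightarrow> reg \<Rightarrow> nat" where
  "query_input a I =
    (case I of
      None \<Rightarrow> (\<lambda>_. 0)(0 := a)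
    | Some (s, e) \<Rightarrow> (\<lambda>_. 0)(0 := a, 1 := 1, 2 := s, 3 := e))"

definition query_output :: "(reg \<Rightarrow> nat) \<Rightarrow> (nat \<times> nat) option" where
  "query_output R = (if R 1 = 0 then None else Some (R 2, R 3))"

section \<open>Resource bounds\<close>

definition space_bound :: "nat \<Rightarrow> nat list \<Rightarrow> real" where
  "space_bound \<sigma> T =
    (let n = real (length T); r = real (num_runs (bwt T))
     in r * log 2 (n / r) + r * log 2 (real \<sigma>) + real \<sigma>)"

definition time_bound :: "nat \<Rightarrow> nat list \<Rightarrow> real" where
  "time_bound a T = 1 + log 2 (real (max (num_runs_of a (bwt T)) 1))"

text \<open>Parameters \<open>c\<close> and \<open>w\<close> of the machine: \<open>w\<close> is between \<open>log n / c\<close> and \<open>c * log n\<close>, and text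
  positions and characters fit in \<open>c\<close> words. Since \<open>w\<close> is positive, this entails \<open>n \<ge> 2\<close>.\<close>

definition word_size_ok :: "nat \<Rightarrow> nat \<Rightarrow> nat \<Rightarrow> nat \<Rightarrow> bool" where
  "word_size_ok c w n \<sigma> \<longleftrightarrow>
    0 < w \<and> log 2 (real n) \<le> real (c * w) \<and> real w \<le> real c * log 2 (real n) \<and> \<sigma> \<le> 2 ^ (c * w)"

end

theory Submission
  imports Defs "HOL-Library.Discrete_Functions"
begin

text \<open>By the LF mapping, the interval of \<open>a # P\<close> has endpoints \<open>C a + rank a s\<close> and
  \<open>C a + rank a (e + 1) - 1\<close>, where \<open>rank a i\<close> counts the copies of \<open>a\<close> in the first \<open>i\<close> positions of
  the transform. As a function of \<open>i\<close> this is piecewise linear, with \<open>2 r\<^sub>a\<close> changes of slope. Adding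
  the multiples of a stride \<open>S \<approx> n / r\<^sub>a\<close> as breakpoints, consecutive breakpoints differ by at most
  \<open>S\<close>, so that a difference takes \<open>O(log (n / r\<^sub>a))\<close> bits in fixed width, and there are still only
  \<open>O(r\<^sub>a)\<close> breakpoints. They are stored in groups of \<open>g \<approx> log r\<^sub>a\<close>, each preceded by its absolute
  position and rank; this costs \<open>O((r\<^sub>a / g) log n) = O(r\<^sub>a (log (n / r\<^sub>a) + 1))\<close> bits because
  \<open>log n = log (n / r\<^sub>a) + log r\<^sub>a\<close>. A query is a binary search over the groups followed by a linear
  scan of one group. By concavity the tables take \<open>O(r log (n / r) + r log \<sigma>)\<close> bits in total.

  A character is mapped to its table in constant time by a trie of depth two whose nodes branch into
  \<open>\<lfloor>\<surd>w\<rfloor>\<close> children and occupy \<open>O(w)\<close> bits: the \<open>O(\<sigma> / w + 1)\<close> top nodes cost \<open>O(\<sigma> + w)\<close> bits, and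
  every occurring character may be charged \<open>O(w)\<close> bits.\<close>

section \<open>The LF mapping\<close>

text \<open>Charging \<open>O(w)\<close> bits to a character is legitimate even if it has a single
  run: \<open>gsize a \<le> r a\<close> gives
  \<open>log 2 n \<le> r a * (log 2 (n / r a) + 1)\<close>, and the machine model bounds
  \<open>w\<close> by \<open>c * log 2 n\<close>. This pays for headers, second-level nodes and
  incomplete groups. A top node of \<open>O(c * w)\<close> bits serves
  \<open>br * br \<ge> w / 4\<close> characters, hence costs \<open>O(c)\<close> bits per character
  of the alphabet. The formal obstacle is that one fixed program must serve all texts and word
  sizes, with registers that wrap around and a memory that blocks outside accesses. Therefore the
  structure stores \<open>w\<close> in its first cell; absolute numbers have width
  \<open>K = 16 * c * w\<close>, enough to address every bit of the structure; and registers have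
  \<open>48 * c + 3\<close> words, so that sums of a few such numbers do not wrap. Time is split
  into a static cost of the program text and one factor \<open>N\<close> that exceeds the iteration
  bound of every loop.\<close>

locale bw_text =
  fixes \<sigma> :: nat and T :: "nat list"
  assumes valid: "valid_text \<sigma> T" and length_ge_2: "2 \<le> length T"
begin

abbreviation "n \<equiv> length T"
abbreviation "SA \<equiv> suffix_array T"
abbreviation "L \<equiv> bwt T"
abbreviation "suf j \<equiv> drop j T"

text \<open>\<open>C a\<close> is counted in \<open>T\<close>, as it stands for the suffixes with a
  smaller first character. The rank excludes position \<open>i\<close> itself, so that a closed
  interval is queried at \<open>s\<close> and \<open>Suc e\<close>.\<close>

definition lf :: "nat \<Rightarrow> nat \<Rightarrow> nat" where
  "lf a i = card {j. j < n \<and> T ! j < a} + card {j. j < i \<and> L ! j = a}"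

lemma length_SA [simp]: "length SA = n"
  by (simp add: suffix_array_def)

lemma length_L [simp]: "length L = n"
  by (simp add: bwt_def)

lemma set_SA: "set SA = {..<n}"
  by (auto simp: suffix_array_def)

lemma distinct_SA: "distinct SA"
  by (simp add: suffix_array_def)

lemma SA_less_n: "i < n \<Longrightarrow> SA ! i < n"
  using set_SA nth_mem[of i SA] by auto

lemma SA_surj: "j < n \<Longrightarrow> \<exists>i<n. SA ! i = j"
  using set_SA by (metis in_set_conv_nth length_SA lessThan_iff)

lemma SA_eq_iff: "i < n \<Longrightarrow> j < n \<Longrightarrow> SA ! i = SA ! j \<longleftrightarrow> i = j"
  using distinct_SA by (simp add: nth_eq_iff_index_eq)

lemma suf_SA_less:
  assumes "i < j" "j < n"
  shows "suf (SA ! i) < suf (SA ! j)"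
proof -
  have "sorted (map suf SA)" by (simp add: suffix_array_def)
  hence "suf (SA ! i) \<le> suf (SA ! j)"
    using sorted_nth_mono[of "map suf SA" i j] assms by simp
  moreover have "suf (SA ! i) \<noteq> suf (SA ! j)"
  proof
    assume "suf (SA ! i) = suf (SA ! j)"
    hence "n - SA ! i = n - SA ! j" by (metis length_drop)
    with SA_less_n[of i] SA_less_n[of j] assms have "SA ! i = SA ! j" by linarith
    with SA_eq_iff[of i j] assms show False by simp
  qed
  ultimately show ?thesis by simp
qed

lemma suf_SA_less_iff: "i < n \<Longrightarrow> j < n \<Longrightarrow> suf (SA ! i) < suf (SA ! j) \<longleftrightarrow> i < j"
  using suf_SA_less[of i j] suf_SA_less[of j i] by (metis linorder_neqE_nat order_less_asym)

text \<open>\<open>(!) SA\<close> is an order isomorphism from indices to suffixes, so an index can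
  be recovered by counting smaller suffixes.\<close>

lemma card_suf_less:
  assumes "i < n"
  shows "card {j. j < n \<and> suf j < suf (SA ! i)} = i"
proof -
  have "{j. j < n \<and> suf j < suf (SA ! i)} = (!) SA ` {..<i}"
  proof (intro set_eqI iffI)
    fix j assume "j \<in> {j. j < n \<and> suf j < suf (SA ! i)}"
    moreover then obtain i' where "i' < n" "SA ! i' = j" using SA_surj by auto
    ultimately show "j \<in> (!) SA ` {..<i}" using suf_SA_less_iff[of i' i] assms by auto
  qed (use assms suf_SA_less_iff SA_less_n in auto)
  moreover have "inj_on ((!) SA) {..<i}" using assms by (auto simp: inj_on_def SA_eq_iff)
  ultimately show ?thesis by (simp add: card_image)
qed

lemma nth_L: "i < n \<Longrightarrow> L ! i = (if SA ! i = 0 then last T else T ! (SA ! i - 1))"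
proof -
  assume i: "i < n"
  have "SA ! i \<noteq> 0 \<Longrightarrow> nat ((int (SA ! i) - 1) mod int n) = SA ! i - 1"
    using SA_less_n[OF i] by (simp add: nat_diff_distrib)
  moreover have "(-1) mod int n = int n - 1"
    by (rule zmod_minus1) (use length_ge_2 in linarith)
  hence "nat ((int 0 - 1) mod int n) = n - 1"
    by simp
  moreover have "T \<noteq> []" using length_ge_2 by auto
  ultimately show ?thesis using i by (auto simp: bwt_def last_conv_nth)
qed

lemma last_T_less: "j < n - 1 \<Longrightarrow> last T < T ! j"
  using valid nth_mem[of j "butlast T"] by (auto simp: valid_text_def nth_butlast)

lemma nth_eq_last_iff: "j < n \<Longrightarrow> T ! j = last T \<longleftrightarrow> j = n - 1"
proof -
  assume "j < n"
  moreover have "T ! (n - 1) = last T" using length_ge_2 by (subst last_conv_nth) auto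
  ultimately show ?thesis using last_T_less[of j] by (cases "j < n - 1") auto
qed

lemma suf_Cons: "j < n \<Longrightarrow> suf j = T ! j # suf (Suc j)"
  by (simp add: Cons_nth_drop_Suc)

text \<open>The suffixes below the one at \<open>SA ! i - 1\<close> either start with a smaller
  character, which gives the first summand of \<open>lf\<close>, or start with \<open>a\<close> and
  continue with a suffix from a row before \<open>i\<close>; the latter correspond to the earlier
  occurrences of \<open>a\<close> in \<open>L\<close>. Excluding the terminator excludes the
  wrap-around at text position 0.\<close>

lemma lf_mapping:
  assumes i: "i < n" and a: "L ! i = a" "a \<noteq> last T"
  shows "0 < SA ! i \<and> lf a i < n \<and> SA ! lf a i = SA ! i - 1"
proof -
  have pos: "0 < SA ! i" using nth_L[OF i] a by (auto split: if_splits)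
  define j where "j = SA ! i - 1"
  have j: "j < n" "Suc j = SA ! i" "T ! j = a"
    using SA_less_n[OF i] pos nth_L[OF i] a by (auto simp: j_def)
  obtain i' where i': "i' < n" "SA ! i' = j" using SA_surj j by auto
  let ?A = "{x. x < n \<and> T ! x < a}" and ?B = "{x. x < n \<and> T ! x = a \<and> suf (Suc x) < suf (Suc j)}"
  have "{x. x < n \<and> suf x < suf j} = ?A \<union> ?B"
    using j suf_Cons by auto
  moreover have "?A \<inter> ?B = {}" by auto
  ultimately have "i' = card ?A + card ?B"
    using card_suf_less[OF i'(1)] i'(2) by (simp add: card_Un_disjoint)
  moreover have "?B = (\<lambda>i. SA ! i - 1) ` {i'. i' < i \<and> L ! i' = a}"
  proof (intro set_eqI iffI)
    fix x assume x: "x \<in> ?B"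
    hence "Suc x < n" using nth_eq_last_iff[of x] a by auto
    then obtain i'' where i'': "i'' < n" "SA ! i'' = Suc x" using SA_surj by blast
    hence "i'' < i" using x suf_SA_less_iff[of i'' i] i j by auto
    moreover have "L ! i'' = a" using nth_L[of i''] i'' x by auto
    ultimately show "x \<in> (\<lambda>i. SA ! i - 1) ` {i'. i' < i \<and> L ! i' = a}"
      using i'' by (intro image_eqI[of _ _ i'']) auto
  next
    fix x assume "x \<in> (\<lambda>i. SA ! i - 1) ` {i'. i' < i \<and> L ! i' = a}"
    then obtain i'' where i'': "i'' < i" "L ! i'' = a" "x = SA ! i'' - 1" by auto
    hence "SA ! i'' \<noteq> 0" using nth_L[of i''] a i by (auto split: if_splits)
    thus "x \<in> ?B" using i'' i j SA_less_n[of i''] nth_L[of i''] suf_SA_less[of i'' i]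
      by auto
  qed
  moreover have "inj_on (\<lambda>i. SA ! i - 1) {i'. i' < i \<and> L ! i' = a}"
  proof (rule inj_onI)
    fix x y assume xy: "x \<in> {i'. i' < i \<and> L ! i' = a}" "y \<in> {i'. i' < i \<and> L ! i' = a}"
      "SA ! x - 1 = SA ! y - 1"
    hence "SA ! x \<noteq> 0" "SA ! y \<noteq> 0" using nth_L[of x] nth_L[of y] a i by (auto split: if_splits)
    with xy i SA_eq_iff[of x y] show "x = y" by auto
  qed
  ultimately have "i' = lf a i" by (simp add: lf_def card_image)
  with pos i' j show ?thesis by auto
qed

lemma lf_Suc: "lf a (Suc i) = lf a i + of_bool (L ! i = a)"
proof -
  have "{j. j < Suc i \<and> L ! j = a} =
      (if L ! i = a then insert i {j. j < i \<and> L ! j = a} else {j. j < i \<and> L ! j = a})"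
    by (auto simp: less_Suc_eq)
  thus ?thesis by (simp add: lf_def)
qed

text \<open>\<open>lf a\<close> grows by one exactly at the occurrences of \<open>a\<close>, so its
  values there leave no gap.\<close>

lemma lf_image:
  assumes "s \<le> e"
  shows "lf a ` {i \<in> {s..<e}. L ! i = a} = {lf a s..<lf a e}"
  using assms
proof (induction e rule: dec_induct)
  case (step e)
  have "{i \<in> {s..<Suc e}. L ! i = a} =
      (if L ! e = a then insert e {i \<in> {s..<e}. L ! i = a} else {i \<in> {s..<e}. L ! i = a})"
    using step by (auto simp: less_Suc_eq)
  moreover have "lf a s \<le> lf a e"
    using step(1) by (induction e rule: dec_induct) (auto simp: lf_Suc)
  ultimately show ?case using step by (auto simp: lf_Suc)
qed simp

lemma sa_indices_Cons:
  assumes P: "sa_indices T P = {s..e}" "s \<le> e" "e < n" and a: "a \<noteq> last T"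
  shows "sa_indices T (a # P) = {lf a s..<lf a (Suc e)}"
proof -
  have "sa_indices T (a # P) = lf a ` {i \<in> {s..e}. L ! i = a}"
  proof (intro set_eqI iffI)
    fix i' assume i': "i' \<in> sa_indices T (a # P)"
    let ?j = "SA ! i'"
    have j: "i' < n" "?j < n" "T ! ?j = a" "prefix P (suf (Suc ?j))"
      using i' suf_Cons[of ?j] SA_less_n by (auto simp: sa_indices_def)
    hence "Suc ?j < n" using nth_eq_last_iff[of ?j] a by auto
    then obtain i where i: "i < n" "SA ! i = Suc ?j" using SA_surj by blast
    have "i \<in> {s..e}" using P(1)[symmetric] i j by (simp add: sa_indices_def)
    moreover have La: "L ! i = a" using nth_L i j by simp
    moreover have "lf a i = i'" using lf_mapping[OF i(1) La a] i j SA_eq_iff by auto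
    ultimately show "i' \<in> lf a ` {i \<in> {s..e}. L ! i = a}" by auto
  next
    fix i' assume "i' \<in> lf a ` {i \<in> {s..e}. L ! i = a}"
    then obtain i where i: "i \<in> {s..e}" "L ! i = a" "i' = lf a i" by auto
    have m: "0 < SA ! i" "i' < n" "SA ! i' = SA ! i - 1"
      using lf_mapping[of i a] i P(3) a by auto
    have "i < n" "prefix P (suf (SA ! i))" using i(1) P(1)[symmetric] by (auto simp: sa_indices_def)
    thus "i' \<in> sa_indices T (a # P)"
      using m suf_Cons[of "SA ! i'"] SA_less_n[of i'] nth_L[of i] i by (auto simp: sa_indices_def)
  qed
  also have "{s..e} = {s..<Suc e}" by auto
  also have "lf a ` {i \<in> {s..<Suc e}. L ! i = a} = {lf a s..<lf a (Suc e)}"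
    using P by (intro lf_image) simp
  finally show ?thesis .
qed

lemma sa_interval_bounds:
  assumes "sa_interval T P = Some (s, e)"
  shows "s \<le> e" "e < n"
proof -
  have ne: "sa_indices T P \<noteq> {}" using assms by (auto simp: sa_interval_def split: if_splits)
  thus "s \<le> e" using sa_indices_eq_interval[OF assms] by auto
  hence "e \<in> sa_indices T P" using sa_indices_eq_interval[OF assms] by auto
  thus "e < n" by (simp add: sa_indices_def)
qed

lemma sa_interval_Cons:
  assumes "sa_interval T P = Some (s, e)" "a \<noteq> last T"
  shows "sa_interval T (a # P) =
    (if lf a s < lf a (Suc e) then Some (lf a s, lf a (Suc e) - 1) else None)"
proof -
  have *: "sa_indices T (a # P) = {lf a s..<lf a (Suc e)}"
    using sa_indices_Cons sa_indices_eq_interval sa_interval_bounds assms by blast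
  show ?thesis
  proof (cases "lf a s < lf a (Suc e)")
    case True
    hence "{lf a s..<lf a (Suc e)} = {lf a s..lf a (Suc e) - 1}" by auto
    with True * show ?thesis by (auto simp: sa_interval_def Min_eq_iff Max_eq_iff)
  qed (auto simp: sa_interval_def *)
qed

text \<open>Justifies the answer for a character that the directory does not find and for which no
  table exists.\<close>

lemma sa_interval_Cons_absent:
  assumes "sa_interval T P = Some (s, e)" "a \<noteq> last T" "a \<notin> set L"
  shows "sa_interval T (a # P) = None"
proof -
  have "{i \<in> {s..<Suc e}. L ! i = a} = {}"
    using assms(3) sa_interval_bounds[OF assms(1)] nth_mem[of _ L] by fastforce
  hence "{lf a s..<lf a (Suc e)} = {}"
    using lf_image[of s "Suc e" a] sa_interval_bounds[OF assms(1)] by auto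
  thus ?thesis using sa_interval_Cons[OF assms(1,2)] by simp
qed

lemma sa_interval_Cons_None:
  assumes "sa_interval T P = None"
  shows "sa_interval T (a # P) = None"
proof -
  have empty: "sa_indices T P = {}" using assms by (auto simp: sa_interval_def split: if_splits)
  have "i \<notin> sa_indices T (a # P)" for i
  proof
    assume i: "i \<in> sa_indices T (a # P)"
    hence j: "SA ! i < n" "prefix P (suf (Suc (SA ! i)))"
      using suf_Cons[of "SA ! i"] SA_less_n by (auto simp: sa_indices_def)
    show False
    proof (cases "Suc (SA ! i) < n")
      case True
      then obtain i' where "i' < n" "SA ! i' = Suc (SA ! i)" using SA_surj by blast
      with j empty show False by (auto simp: sa_indices_def)
    next
      case False
      \<comment> \<open>Only the empty suffix is left behind the last position, and
        \<open>[]\<close> matches in every row.\<close>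
      with j have "P = []" by simp
      with empty i show False by (auto simp: sa_indices_def)
    qed
  qed
  thus ?thesis by (auto simp: sa_interval_def)
qed

section \<open>The terminator and the empty pattern\<close>

lemma SA_0: "SA ! 0 = n - 1"
proof -
  have n: "0 < n" "n - 1 < n" using length_ge_2 by auto
  obtain i where i: "i < n" "SA ! i = n - 1" using SA_surj n(2) by blast
  have "{j. j < n \<and> suf j < suf (SA ! i)} = {}"
  proof -
    have "\<not> suf j < suf (n - 1)" if "j < n" for j
      using suf_Cons[OF that] suf_Cons[OF n(2)] nth_eq_last_iff[OF that] nth_eq_last_iff[OF n(2)]
        last_T_less[of j] that
      by (cases "j < n - 1") auto
    thus ?thesis using i by auto
  qed
  with card_suf_less[OF i(1)] have "i = 0" by (metis card.empty)
  with i show ?thesis by simp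
qed

text \<open>A nonempty pattern matching at every position would make the first and the last
  character of the text equal, but the terminator is unique and \<open>n \<ge> 2\<close>.\<close>

lemma sa_interval_full_iff:
  assumes "sa_interval T P = Some (s, e)"
  shows "(s = 0 \<and> Suc e = n) \<longleftrightarrow> P = []"
proof
  assume "P = []"
  hence "sa_indices T P = {..<n}" by (auto simp: sa_indices_def)
  hence I: "{s..e} = {..<n}" using sa_indices_eq_interval[OF assms] by simp
  have "0 \<in> {s..e}" "n - 1 \<in> {s..e}" using length_ge_2 by (auto simp only: I lessThan_iff)
  thus "s = 0 \<and> Suc e = n" using sa_interval_bounds[OF assms] by simp
next
  assume se: "s = 0 \<and> Suc e = n"
  have all: "prefix P (suf j)" if j: "j < n" for j
  proof -
    obtain i where i: "i < n" "SA ! i = j" using SA_surj j by blast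
    have "i \<in> {s..e}" using se i(1) by simp
    hence "i \<in> sa_indices T P" using sa_indices_eq_interval[OF assms] by simp
    with i show ?thesis by (simp add: sa_indices_def)
  qed
  show "P = []"
  proof (cases P)
    case (Cons p P')
    have p: "p = T ! j" if "j < n" for j
      using all[OF that] unfolding Cons suf_Cons[OF that] by simp
    have "0 < n" "n - 1 < n" "0 \<noteq> n - 1" using length_ge_2 by auto
    with p[of 0] p[of "n - 1"] nth_eq_last_iff show ?thesis by metis
  qed
qed

lemma sa_interval_terminator:
  "sa_interval T (last T # P) = (if P = [] then Some (0, 0) else None)"
proof -
  have n: "n - 1 < n" using length_ge_2 by auto
  have "i \<in> sa_indices T (last T # P) \<longleftrightarrow> i = 0 \<and> P = []" for i
  proof (cases "i < n")
    case i: True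
    have "prefix (last T # P) (suf (SA ! i)) \<longleftrightarrow>
        SA ! i = n - 1 \<and> prefix P (suf (Suc (SA ! i)))"
      using suf_Cons[OF SA_less_n[OF i]] nth_eq_last_iff[OF SA_less_n[OF i]] by auto
    also have "\<dots> \<longleftrightarrow> i = 0 \<and> P = []"
      using SA_eq_iff[OF i, of 0] SA_0 n by fastforce
    finally show ?thesis using i by (simp add: sa_indices_def)
  qed (use length_ge_2 in \<open>auto simp: sa_indices_def\<close>)
  hence "sa_indices T (last T # P) = (if P = [] then {0} else {})" by auto
  thus ?thesis by (cases "P = []") (simp_all add: sa_interval_def)
qed

lemma lf_le: "i \<le> n \<Longrightarrow> lf a i \<le> 2 * n"
proof -
  assume "i \<le> n"
  moreover have "card {j. j < n \<and> T ! j < a} \<le> card {..<n}" by (rule card_mono) auto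
  moreover have "card {j. j < i \<and> L ! j = a} \<le> card {..<i}" by (rule card_mono) auto
  ultimately show ?thesis by (simp add: lf_def)
qed

lemma set_L_subset: "set L \<subseteq> {..<\<sigma>}"
proof
  fix x assume "x \<in> set L"
  then obtain i where "i < n" "x = L ! i" by (metis in_set_conv_nth length_L)
  hence "x \<in> set T" using nth_L[of i] SA_less_n[of i] length_ge_2
    by (auto intro!: nth_mem last_in_set)
  thus "x \<in> {..<\<sigma>}" using valid by (auto simp: valid_text_def)
qed

end

section \<open>Reading bit fields from memory\<close>

text \<open>The least significant bit comes first, so that concatenating cells, with later ones
  shifted further left, concatenates their bit lists.\<close>

abbreviation bits_val :: "bool list \<Rightarrow> nat" where
  "bits_val \<equiv> horner_sum of_bool 2"

text \<open>Bits beyond the end of the list read as zero, which fills the last cell and the padding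
  cells.\<close>

definition read_bits :: "bool list \<Rightarrow> nat \<Rightarrow> nat \<Rightarrow> nat" where
  "read_bits bs p l = bits_val (take l (drop p bs))"

lemma bits_val_mod: "bits_val bs mod 2 ^ l = bits_val (take l bs)"
  using take_bit_horner_sum_bit_eq[of l bs] by (simp add: take_bit_eq_mod)

lemma bits_val_div: "bits_val bs div 2 ^ l = bits_val (drop l bs)"
proof (cases "l \<le> length bs")
  case True
  have "bits_val bs = bits_val (take l bs) + 2 ^ l * bits_val (drop l bs)"
    using horner_sum_append[of of_bool 2 "take l bs" "drop l bs"] True by simp
  moreover have "bits_val (take l bs) < 2 ^ l"
    using horner_sum_of_bool_2_less[of "take l bs"] True by simp
  ultimately show ?thesis by simp
next
  case False
  hence "bits_val bs < 2 ^ l"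
    using horner_sum_of_bool_2_less[of bs]
    by (metis less_le_trans linorder_not_le order_less_imp_le power_increasing_iff one_less_numeral_iff semiring_norm(76))
  with False show ?thesis by simp
qed

lemma bits_val_less: "length bs \<le> l \<Longrightarrow> bits_val bs < 2 ^ l"
  by (rule less_le_trans[OF horner_sum_of_bool_2_less power_increasing]) auto

section \<open>A small structured language on top of the machine\<close>

datatype aexp = Num nat | Var reg | Bin binop aexp aexp | Read aexp aexp

text \<open>Register 4 holds the word size; registers from 100 on are temporaries. \<open>load_words j d\<close>
  concatenates \<open>j\<close> consecutive cells, which suffices for a field of at most \<open>j - 1\<close> words.\<close>

fun load_words :: "nat \<Rightarrow> reg \<Rightarrow> com" where
  "load_words 0 d = Skip"
| "load_words (Suc j) d = Seq (load_words j d)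
    (Seq (Load (d + 6) (d + 2)) (Seq (Op ShiftLeft (d + 6) (d + 6) (d + 5))
    (Seq (Op Add (d + 4) (d + 4) (d + 6)) (Seq (Op Add (d + 2) (d + 2) (d + 3))
    (Op Add (d + 5) (d + 5) 4)))))"

text \<open>Registers from \<open>d\<close> on form an evaluation stack, with the result in
  \<open>d\<close>; \<open>BitOr\<close> of a register with itself is a copy. A field is read by
  loading \<open>J\<close> cells from its first cell on, shifting out the offset within that cell
  and reducing modulo \<open>2 ^ l\<close>.\<close>

fun compile :: "nat \<Rightarrow> aexp \<Rightarrow> reg \<Rightarrow> com" where
  "compile J (Num v) d = Const d v"
| "compile J (Var x) d = Op BitOr d x x"
| "compile J (Bin f e1 e2) d = Seq (compile J e1 d) (Seq (compile J e2 (d + 1)) (Op f d d (d + 1)))"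
| "compile J (Read p l) d = Seq (compile J p d) (Seq (compile J l (d + 1))
    (Seq (Op Divide (d + 2) d 4) (Seq (Op Modulo d d 4) (Seq (Const (d + 3) 1)
    (Seq (Const (d + 4) 0) (Seq (Const (d + 5) 0) (Seq (load_words J d)
    (Seq (Op ShiftRight (d + 4) (d + 4) d) (Seq (Op ShiftLeft (d + 3) (d + 3) (d + 1))
    (Op Modulo d (d + 4) (d + 3)))))))))))"

definition assign :: "nat \<Rightarrow> reg \<Rightarrow> aexp \<Rightarrow> com" where
  "assign J x e = Seq (compile J e 100) (Op BitOr x 100 100)"

fun wf_exp :: "aexp \<Rightarrow> bool" where
  "wf_exp (Num v) = True"
| "wf_exp (Var x) = (x < 100)"
| "wf_exp (Bin f e1 e2) = (wf_exp e1 \<and> wf_exp e2)"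
| "wf_exp (Read p l) = (wf_exp p \<and> wf_exp l)"

text \<open>The value 0 for bitwise operations is a dummy: \<open>no_overflow\<close> rejects them,
  so they never occur in a safe expression.\<close>

fun nat_op :: "binop \<Rightarrow> nat \<Rightarrow> nat \<Rightarrow> nat" where
  "nat_op Add x y = x + y"
| "nat_op Sub x y = x - y"
| "nat_op Mult x y = x * y"
| "nat_op Divide x y = x div y"
| "nat_op Modulo x y = x mod y"
| "nat_op Less x y = (if x < y then 1 else 0)"
| "nat_op Equal x y = (if x = y then 1 else 0)"
| "nat_op _ x y = 0"

fun no_overflow :: "nat \<Rightarrow> binop \<Rightarrow> nat \<Rightarrow> nat \<Rightarrow> bool" where
  "no_overflow B Add x y = (x + y < B)"
| "no_overflow B Sub x y = (y \<le> x \<and> x < B)"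
| "no_overflow B Mult x y = (x * y < B)"
| "no_overflow B Divide x y = True"
| "no_overflow B Modulo x y = True"
| "no_overflow B Less x y = True"
| "no_overflow B Equal x y = True"
| "no_overflow B _ x y = False"

lemma apply_op_eq_nat_op: "no_overflow (2 ^ b) f x y \<Longrightarrow> apply_op b f x y = nat_op f x y"
proof (induction "2 ^ b :: nat" f x y rule: no_overflow.induct)
  case (2 x y)
  hence "x + (2 ^ b - y) = (x - y) + 2 ^ b" "x - y < 2 ^ b" by auto
  thus ?case by simp
qed auto

text \<open>The running time of a command in which every loop body is executed at most once.\<close>

fun cost :: "com \<Rightarrow> nat" where
  "cost (Seq c1 c2) = cost c1 + cost c2"
| "cost (IfNZ x c1 c2) = cost c1 + cost c2 + 1"
| "cost (WhileNZ x c) = cost c + 2"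
| "cost _ = 1"

text \<open>The \<open>J\<close> cells in excess of \<open>length bs div w\<close> allow a read to
  start at any bit address up to \<open>length bs\<close> and still find \<open>J\<close> cells;
  \<open>J \<le> k\<close> makes their concatenation fit in a register.\<close>

locale machine =
  fixes w k J :: nat and bs :: "bool list" and M :: "nat list"
  assumes w_pos: "0 < w"
    and J_le: "J \<le> k"
    and M_eq: "M = map (\<lambda>i. read_bits bs (i * w) w) [0..<length M]"
    and length_M: "length bs div w + J \<le> length M"
    and length_M_less: "length M < 2 ^ (k * w)"
begin

abbreviation "B \<equiv> (2::nat) ^ (k * w)"

section \<open>Semantics of expressions and correctness of their compilation\<close>

fun eval :: "aexp \<Rightarrow> (reg \<Rightarrow> nat) \<Rightarrow> nat" where
  "eval (Num v) U = v"
| "eval (Var x) U = U x"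
| "eval (Bin f e1 e2) U = nat_op f (eval e1 U) (eval e2 U)"
| "eval (Read p l) U = read_bits bs (eval p U) (eval l U)"

text \<open>A field may start anywhere within a cell, so one word of the \<open>J\<close> loaded
  ones is reserved for the offset.\<close>

fun safe :: "aexp \<Rightarrow> (reg \<Rightarrow> nat) \<Rightarrow> bool" where
  "safe (Num v) U = (v < B)"
| "safe (Var x) U = True"
| "safe (Bin f e1 e2) U = (safe e1 U \<and> safe e2 U \<and> no_overflow B f (eval e1 U) (eval e2 U))"
| "safe (Read p l) U = (safe p U \<and> safe l U \<and> eval p U \<le> length bs \<and> eval l U + w \<le> J * w)"

lemma eval_safe_cong:
  assumes "wf_exp e" "\<And>x. x < 100 \<Longrightarrow> U x = U' x"
  shows "eval e U = eval e U'" "safe e U = safe e U'"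
  using assms by (induction e) auto

text \<open>Total correctness with a time bound from a single start state. The memory must come back
  unchanged, as a query only reads it.\<close>

definition hoare :: "com \<Rightarrow> (reg \<Rightarrow> nat) \<Rightarrow> ((reg \<Rightarrow> nat) \<Rightarrow> bool) \<Rightarrow> bool" where
  "hoare c R Q \<longleftrightarrow> (\<exists>R' t. exec w k c (M, R) t (M, R') \<and> t \<le> cost c \<and> Q R')"

lemma hoare_Seq: "hoare c1 R (\<lambda>R'. hoare c2 R' Q) \<Longrightarrow> hoare (Seq c1 c2) R Q"
  unfolding hoare_def by (auto intro: exec.Seq) (metis exec.Seq add_mono)

lemma hoare_Skip: "Q R \<Longrightarrow> hoare Skip R Q"
  unfolding hoare_def by (intro exI conjI, rule exec.Skip) auto

lemma hoare_Const: "Q (R(x := v mod B)) \<Longrightarrow> hoare (Const x v) R Q"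
  unfolding hoare_def by (intro exI conjI, rule exec.Const) auto

lemma hoare_Op: "Q (R(x := apply_op (k * w) f (R y) (R z))) \<Longrightarrow> hoare (Op f x y z) R Q"
  unfolding hoare_def by (intro exI conjI, rule exec.Op) auto

lemma hoare_Load: "R y < length M \<Longrightarrow> Q (R(x := M ! R y)) \<Longrightarrow> hoare (Load x y) R Q"
  unfolding hoare_def by (intro exI conjI, rule exec.Load) auto

lemmas hoare_intros = hoare_Seq hoare_Skip hoare_Const hoare_Op hoare_Load

lemma read_bits_add: "read_bits bs p (i + j) = read_bits bs p i + 2 ^ i * read_bits bs (p + i) j"
proof (cases "i \<le> length (drop p bs)")
  case True
  thus ?thesis
    by (simp add: read_bits_def take_add horner_sum_append add.commute)
qed (simp add: read_bits_def)

lemma nth_M: "i < length M \<Longrightarrow> M ! i = read_bits bs (i * w) w"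
  by (subst M_eq) simp

lemma hoare_load_words:
  assumes "q + j \<le> length M" "j \<le> J" "R 4 = w" "4 < d"
    and "R (d + 2) = q" "R (d + 3) = 1" "R (d + 4) = 0" "R (d + 5) = 0"
    and Q: "\<And>R'. R' (d + 4) = read_bits bs (q * w) (j * w) \<Longrightarrow> R' (d + 5) = j * w \<Longrightarrow>
      R' (d + 2) = q + j \<Longrightarrow> R' (d + 3) = 1 \<Longrightarrow>
      (\<forall>x. x \<le> d + 1 \<longrightarrow> R' x = R x) \<Longrightarrow> Q R'"
  shows "hoare (load_words j d) R Q"
  using assms
proof (induction j arbitrary: Q)
  case 0
  thus ?case by (simp add: hoare_Skip read_bits_def)
next
  case (Suc j)
  show ?case
    unfolding load_words.simps
  proof (rule hoare_Seq, rule Suc.IH, goal_cases)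
    case (9 R')
    have jk: "Suc j * w \<le> k * w" using Suc.prems(2) J_le by (intro mult_right_mono) auto
    have B_eq: "2 ^ (Suc j * w) \<le> B" by (intro power_increasing) (use jk in auto)
    have lB: "k * w < B" by (rule less_exp)
    \<comment> \<open>A cell shifted by \<open>j\<close> words ends below bit
      \<open>Suc j * w\<close>, which lies within the register because
      \<open>J \<le> k\<close>.\<close>
    have v: "M ! (q + j) * 2 ^ (j * w) < 2 ^ (Suc j * w)"
      using Suc.prems(1) bits_val_less[of "take w (drop ((q + j) * w) bs)" w]
      by (simp add: nth_M read_bits_def power_add)
    have s: "read_bits bs (q * w) (j * w) + 2 ^ (j * w) * M ! (q + j) =
        read_bits bs (q * w) (Suc j * w)"
      using Suc.prems(1) read_bits_add[of "q * w" "j * w" w]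
      by (simp add: nth_M add_mult_distrib add.commute)
    have s_less: "read_bits bs (q * w) (Suc j * w) < 2 ^ (Suc j * w)"
      by (simp add: read_bits_def bits_val_less)
    have m: "(M ! (q + j) * 2 ^ (j * w)) mod B = M ! (q + j) * 2 ^ (j * w)"
      "read_bits bs (q * w) (Suc j * w) mod B = read_bits bs (q * w) (Suc j * w)"
      "(j * w + w) mod B = Suc j * w" "Suc (q + j) mod B = Suc (q + j)"
    proof -
      have "j * w + w < B" using le_less_trans[OF jk lB] by simp
      thus "(j * w + w) mod B = Suc j * w" by simp
      have "Suc (q + j) < B" using length_M_less Suc.prems(1) by linarith
      thus "Suc (q + j) mod B = Suc (q + j)" by (rule mod_less)
    qed (rule mod_less, rule less_le_trans[OF _ B_eq], rule v s_less)+
    show ?case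
      apply (intro hoare_intros)
       apply (use 9 Suc.prems in simp)
      apply (rule Suc.prems(9))
          apply (use 9 Suc.prems s m in
            \<open>simp_all add: push_bit_eq_mult mult.commute[of "2 ^ _"] del: mult_Suc\<close>)
      done
  qed (use Suc.prems in auto)
qed

lemma hoare_compile:
  assumes "wf_exp e" "safe e R" "R 4 = w" "100 \<le> d"
    and "\<And>R'. R' d = eval e R \<Longrightarrow> (\<forall>x. x < d \<longrightarrow> R' x = R x) \<Longrightarrow> Q R'"
  shows "hoare (compile J e d) R Q"
  using assms
proof (induction e arbitrary: d R Q)
  case (Num v)
  show ?case unfolding compile.simps by (rule hoare_Const, rule Num) (use Num in auto)
next
  case (Var x)
  show ?case unfolding compile.simps by (rule hoare_Op, rule Var) (use Var in auto)
next
  case (Bin f e1 e2)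
  show ?case
    unfolding compile.simps
  proof (rule hoare_Seq, rule Bin.IH(1), goal_cases)
    case R': (5 R')
    have eq: "eval e2 R' = eval e2 R" "safe e2 R' = safe e2 R"
      by (rule eval_safe_cong; use Bin.prems R' in simp)+
    show ?case
    proof (rule hoare_Seq, rule Bin.IH(2), goal_cases)
      case R'': (5 R'')
      show ?case
        by (rule hoare_Op, rule Bin.prems)
          (use Bin.prems R' R'' eq in \<open>auto simp: apply_op_eq_nat_op\<close>)
    qed (use Bin.prems R' eq in auto)
  qed (use Bin.prems in auto)
next
  case (Read p l)
  let ?p = "eval p R" and ?l = "eval l R"
  have l: "?l + w \<le> J * w" and p: "?p \<le> length bs" using Read.prems(2) by auto
  have "J * w \<le> k * w" using J_le by simp
  with l w_pos have lk: "?l < k * w" by linarith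
  have lB: "2 ^ ?l < B" "?l < B"
    by (rule power_strict_increasing[OF lk], simp) (rule less_trans[OF lk less_exp])
  have "0 < k" using lk by (cases k) auto
  have q: "?p div w + J \<le> length M" using div_le_mono[OF p, of w] length_M by linarith
  \<comment> \<open>The field starts at this offset in the first loaded cell and thus ends within
    the loaded ones.\<close>
  have off: "?p mod w + ?l \<le> J * w" using l mod_less_divisor[OF w_pos, of ?p] by linarith
  show ?case
    unfolding compile.simps
  proof (rule hoare_Seq, rule Read.IH(1), goal_cases)
    case R': (5 R')
    have eq: "eval l R' = eval l R" "safe l R' = safe l R"
      by (rule eval_safe_cong; use Read.prems R' in simp)+
    show ?case
    proof (rule hoare_Seq, rule Read.IH(2), goal_cases)
      case R'': (5 R'')
      have r: "R'' 4 = w" "R'' d = ?p" "R'' (d + 1) = ?l" "\<And>x. x < d \<Longrightarrow> R'' x = R x"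
        using Read.prems R' R'' eq by auto
      show ?case
      proof (intro hoare_Seq hoare_Const hoare_Op, rule hoare_load_words[where q = "?p div w"], goal_cases)
        case (9 S)
        have S: "S d = ?p mod w" "S (d + 1) = ?l" "\<And>x. x < d \<Longrightarrow> S x = R x"
          using 9(5) r Read.prems(4) by auto
        have "read_bits bs ((?p div w) * w) (J * w) div 2 ^ (?p mod w) mod 2 ^ ?l
            = bits_val (take ?l (take (J * w - ?p mod w) (drop (?p div w * w + ?p mod w) bs)))"
          by (simp add: read_bits_def bits_val_div bits_val_mod drop_take add.commute)
        also have "\<dots> = read_bits bs ?p ?l"
          using off by (simp add: read_bits_def min_def)
        finally have *: "read_bits bs ((?p div w) * w) (J * w) div 2 ^ (?p mod w) mod 2 ^ ?l
            = read_bits bs ?p ?l" .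
        show ?case
          apply (intro hoare_intros)
          apply (rule Read.prems(5))
          using 9 S r Read.prems(4) lB * \<open>0 < k\<close> w_pos
           apply (simp_all add: push_bit_eq_mult drop_bit_eq_div)
          done
      qed (use r q Read.prems(4) \<open>0 < k\<close> w_pos in simp_all)
    qed (use Read.prems R' eq in auto)
  qed (use Read.prems in auto)
qed

text \<open>States are compared on the first 100 registers only, so that an assignment has an exact effect
  although the evaluation of its expression clobbers temporaries.\<close>

definition halts :: "nat \<Rightarrow> com \<Rightarrow> (reg \<Rightarrow> nat) \<Rightarrow> ((reg \<Rightarrow> nat) \<Rightarrow> bool) \<Rightarrow> bool" where
  "halts N c U Q \<longleftrightarrow> (\<forall>R. (\<forall>x<100. R x = U x) \<longrightarrow> (\<exists>R' t U'. exec w k c (M, R) t (M, R') \<and>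
    t \<le> N * cost c \<and> (\<forall>x<100. R' x = U' x) \<and> Q U'))"

lemma halts_mono:
  assumes "halts N c U Q" "N \<le> N'" "\<And>U'. Q U' \<Longrightarrow> Q' U'"
  shows "halts N' c U Q'"
  unfolding halts_def
proof (intro allI impI)
  fix R assume "\<forall>x<100. R x = U x"
  then obtain R' t U' where *: "exec w k c (M, R) t (M, R')" "t \<le> N * cost c"
    "\<forall>x<100. R' x = U' x" "Q U'" using assms(1) unfolding halts_def by blast
  have "t \<le> N' * cost c" using *(2) mult_right_mono[OF assms(2)] by (rule order_trans) simp
  with * assms(3) show "\<exists>R' t U'. exec w k c (M, R) t (M, R') \<and>
    t \<le> N' * cost c \<and> (\<forall>x<100. R' x = U' x) \<and> Q' U'" by blast
qed

lemma halts_Skip: "0 < N \<Longrightarrow> Q U \<Longrightarrow> halts N Skip U Q"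
  unfolding halts_def by (intro allI impI exI conjI, rule exec.Skip) auto

lemma halts_assign:
  assumes "0 < N" "wf_exp e" "x < 100" "U 4 = w" "safe e U" "Q (U(x := eval e U))"
  shows "halts N (assign J x e) U Q"
  unfolding halts_def
proof (intro allI impI)
  fix R assume R: "\<forall>y<100. R y = U y"
  have eq: "eval e R = eval e U" "safe e R = safe e U"
    by (rule eval_safe_cong; use assms R in simp)+
  have "hoare (assign J x e) R (\<lambda>R'. \<forall>y<100. R' y = (U(x := eval e U)) y)"
    unfolding assign_def
  proof (rule hoare_Seq, rule hoare_compile)
    fix R' assume "R' 100 = eval e R" "\<forall>y<100. R' y = R y"
    thus "hoare (Op BitOr x 100 100) R' (\<lambda>R'. \<forall>y<100. R' y = (U(x := eval e U)) y)"
      by (intro hoare_Op) (simp add: eq R)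
  qed (use assms eq R in simp_all)
  then obtain R' t where *: "exec w k (assign J x e) (M, R) t (M, R')" "t \<le> cost (assign J x e)"
    "\<forall>y<100. R' y = (U(x := eval e U)) y" unfolding hoare_def by blast
  have "cost (assign J x e) \<le> N * cost (assign J x e)" using assms(1) by simp
  with *(2) have "t \<le> N * cost (assign J x e)" by linarith
  with * show "\<exists>R' t U'. exec w k (assign J x e) (M, R) t (M, R') \<and>
      t \<le> N * cost (assign J x e) \<and> (\<forall>x<100. R' x = U' x) \<and> Q U'"
    using assms(6) by blast
qed

lemma halts_Seq:
  assumes "halts N c1 U (\<lambda>U'. halts N c2 U' Q)"
  shows "halts N (Seq c1 c2) U Q"
  unfolding halts_def
proof (intro allI impI)
  fix R assume "\<forall>x<100. R x = U x"
  then obtain R' t U' where 1: "exec w k c1 (M, R) t (M, R')" "t \<le> N * cost c1"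
    "\<forall>x<100. R' x = U' x" "halts N c2 U' Q" using assms unfolding halts_def[of _ c1] by blast
  then obtain R'' u U'' where 2: "exec w k c2 (M, R') u (M, R'')" "u \<le> N * cost c2"
    "\<forall>x<100. R'' x = U'' x" "Q U''" unfolding halts_def by blast
  have "t + u \<le> N * cost (Seq c1 c2)" using 1 2 by (simp add: algebra_simps)
  with exec.Seq[OF 1(1) 2(1)] 2 show "\<exists>R' t U'. exec w k (Seq c1 c2) (M, R) t (M, R') \<and>
      t \<le> N * cost (Seq c1 c2) \<and> (\<forall>x<100. R' x = U' x) \<and> Q U'" by blast
qed

lemma halts_IfNZ:
  assumes "0 < N" "x < 100" "U x \<noteq> 0 \<Longrightarrow> halts N c1 U Q" "U x = 0 \<Longrightarrow> halts N c2 U Q"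
  shows "halts N (IfNZ x c1 c2) U Q"
  unfolding halts_def
proof (intro allI impI)
  fix R assume R: "\<forall>x<100. R x = U x"
  show "\<exists>R' t U'. exec w k (IfNZ x c1 c2) (M, R) t (M, R') \<and>
      t \<le> N * cost (IfNZ x c1 c2) \<and> (\<forall>x<100. R' x = U' x) \<and> Q U'"
  proof (cases "U x = 0")
    case True
    then obtain R' t U' where 1: "exec w k c2 (M, R) t (M, R')" "t \<le> N * cost c2"
      "\<forall>x<100. R' x = U' x" "Q U'" using assms(4) R unfolding halts_def by blast
    have "exec w k (IfNZ x c1 c2) (M, R) (t + 1) (M, R')"
      using True R assms(2) 1 by (intro exec.IfZero) auto
    moreover have "t + 1 \<le> N * cost (IfNZ x c1 c2)" using 1 assms(1) by (simp add: algebra_simps)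
    ultimately show ?thesis using 1 by blast
  next
    case False
    then obtain R' t U' where 1: "exec w k c1 (M, R) t (M, R')" "t \<le> N * cost c1"
      "\<forall>x<100. R' x = U' x" "Q U'" using assms(3) R unfolding halts_def by blast
    have "exec w k (IfNZ x c1 c2) (M, R) (t + 1) (M, R')"
      using False R assms(2) 1 by (intro exec.IfNonzero) auto
    moreover have "t + 1 \<le> N * cost (IfNZ x c1 c2)" using 1 assms(1) by (simp add: algebra_simps)
    ultimately show ?thesis using 1 by blast
  qed
qed

text \<open>The index of the invariant bounds the remaining iterations and may be generous, as the
  loop may stop early. Bodies are verified with factor 1, since they contain no loops; the slack in
  \<open>j < N\<close> and in the cost of the loop pays for the tests.\<close>

lemma halts_WhileNZ:
  assumes x: "x < 100" and init: "Inv j U" "j < N"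
    and body: "\<And>j U. Inv (Suc j) U \<Longrightarrow> U x \<noteq> 0 \<Longrightarrow> halts 1 c U (Inv j)"
    and zero: "\<And>U. Inv 0 U \<Longrightarrow> U x = 0"
    and exit: "\<And>j U. Inv j U \<Longrightarrow> U x = 0 \<Longrightarrow> Q U"
  shows "halts N (WhileNZ x c) U Q"
proof -
  let ?P = "\<lambda>R j. \<exists>R' t U'. exec w k (WhileNZ x c) (M, R) t (M, R') \<and>
      t \<le> j * (cost c + 1) + 1 \<and> (\<forall>x<100. R' x = U' x) \<and> Q U'"
  have stop: "?P R j" if "\<forall>x<100. R x = U x" "Inv j U" "U x = 0" for R U j
  proof -
    have "exec w k (WhileNZ x c) (M, R) 1 (M, R)"
      by (rule exec.WhileZero) (use that x in simp)
    moreover have "Q U" using exit that(2,3) by blast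
    ultimately show ?thesis using that(1) by (intro exI[of _ R] exI[of _ 1] exI[of _ U]) simp
  qed
  have loop: "?P R j" if "\<forall>x<100. R x = U x" "Inv j U" for R U j
    using that
  proof (induction j arbitrary: R U)
    case 0
    thus ?case using stop zero by blast
  next
    case (Suc j)
    show ?case
    proof (cases "U x = 0")
      case True
      thus ?thesis using stop Suc.prems by blast
    next
      case False
      hence nz: "snd (M, R) x \<noteq> 0" using Suc.prems(1) x by simp
      have "halts 1 c U (Inv j)" using body Suc.prems(2) False by blast
      then obtain R' t U' where 1: "exec w k c (M, R) t (M, R')" "t \<le> 1 * cost c"
        "\<forall>x<100. R' x = U' x" "Inv j U'" using Suc.prems(1) unfolding halts_def by blast
      from Suc.IH[OF 1(3,4)] obtain R'' u U'' where
        2: "exec w k (WhileNZ x c) (M, R') u (M, R'')" "u \<le> j * (cost c + 1) + 1"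
        "\<forall>x<100. R'' x = U'' x" "Q U''" by blast
      have "t + u + 1 \<le> Suc j * (cost c + 1) + 1" using 1 2 by simp
      with exec.WhileNonzero[OF nz 1(1) 2(1)] 2(3,4) show ?thesis by blast
    qed
  qed
  have "Suc j * (cost c + 2) \<le> N * (cost c + 2)" using init(2) by (intro mult_right_mono) auto
  hence le: "t \<le> N * cost (WhileNZ x c)" if "t \<le> j * (cost c + 1) + 1" for t
    using that by simp
  show ?thesis
    unfolding halts_def
  proof (intro allI impI)
    fix R assume "\<forall>x<100. R x = U x"
    from loop[OF this init(1)] le show "\<exists>R' t U'. exec w k (WhileNZ x c) (M, R) t (M, R') \<and>
      t \<le> N * cost (WhileNZ x c) \<and> (\<forall>x<100. R' x = U' x) \<and> Q U'" by blast
  qed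
qed

end

section \<open>Tables, directory nodes and the routines that read them\<close>

definition field :: "nat \<Rightarrow> nat \<Rightarrow> bool list" where
  "field l v = map (bit v) [0..<l]"

lemma length_field [simp]: "length (field l v) = l"
  by (simp add: field_def)

definition occurs_at :: "bool list \<Rightarrow> nat \<Rightarrow> bool list \<Rightarrow> bool" where
  "occurs_at bs p xs \<longleftrightarrow> (\<exists>us vs. bs = us @ xs @ vs \<and> length us = p)"

lemma occurs_at_le: "occurs_at bs p xs \<Longrightarrow> p + length xs \<le> length bs"
  by (auto simp: occurs_at_def)

lemma occurs_at_append:
  "occurs_at bs p (xs @ ys) \<Longrightarrow> occurs_at bs p xs \<and> occurs_at bs (p + length xs) ys"
  unfolding occurs_at_def by (metis append.assoc length_append)

lemma read_field: "occurs_at bs p (field l v) \<Longrightarrow> v < 2 ^ l \<Longrightarrow> read_bits bs p l = v"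
  by (auto simp: occurs_at_def read_bits_def field_def horner_sum_bit_eq_take_bit take_bit_eq_mod)

lemma occurs_at_concat:
  assumes "occurs_at bs p (concat xss)" "i < length xss"
  shows "occurs_at bs (p + length (concat (take i xss))) (xss ! i)"
proof -
  have "concat xss = concat (take i xss) @ xss ! i @ concat (drop (Suc i) xss)"
    using id_take_nth_drop[OF assms(2)] by (metis concat.simps(2) concat_append)
  with assms(1) show ?thesis by (metis occurs_at_append)
qed

lemma length_concat_const:
  assumes "\<And>x. x \<in> set xs \<Longrightarrow> length (f x) = l"
  shows "length (concat (map f xs)) = length xs * l"
  using assms by (induction xs) auto

text \<open>Equal lengths give random access: the address is computed by a multiplication instead of
  being stored.\<close>

lemma occurs_at_concat_const:
  assumes "occurs_at bs p (concat (map f xs))" "\<And>x. x \<in> set xs \<Longrightarrow> length (f x) = l"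
    and "i < length xs"
  shows "occurs_at bs (p + i * l) (f (xs ! i))"
proof -
  have "length (concat (map f (take i xs))) = i * l"
    using assms(2,3) by (subst length_concat_const[of _ _ l]) (auto dest: in_set_takeD)
  with occurs_at_concat[OF assms(1), of i] assms(3) show ?thesis by (simp add: take_map)
qed

lemma occurs_at_concat_upt:
  assumes "occurs_at bs p (concat (map f [0..<m]))" "\<And>j. j < m \<Longrightarrow> length (f j) = l" "i < m"
  shows "occurs_at bs (p + i * l) (f i)"
  using occurs_at_concat_const[OF assms(1), of l i] assms(2,3) by simp

text \<open>A node of the directory: the elements of \<open>X\<close> in \<open>{q * b..<q * b + b}\<close> are numbered from 1,
  and the number of smaller elements of \<open>X\<close> is stored separately, so that \<open>b\<close> bits suffice for
  each of the \<open>b\<close> entries.\<close>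

definition node :: "nat \<Rightarrow> nat \<Rightarrow> nat set \<Rightarrow> nat \<Rightarrow> bool list" where
  "node K b X q = field K (card {x \<in> X. x < q * b}) @
    concat (map (\<lambda>j. field b (if q * b + j \<in> X then Suc (card {x \<in> X. q * b \<le> x \<and> x < q * b + j}) else 0)) [0..<b])"

lemma length_node [simp]: "length (node K b X q) = K + b * b"
  by (simp add: node_def length_concat_const[of _ _ b])

text \<open>Register 10 holds the address of a node and register 11 an index in it. Register 12
  receives 0 for absence and otherwise one plus the rank in \<open>X\<close>.\<close>

definition lookup_com :: "nat \<Rightarrow> com" where
  "lookup_com J =
    Seq (assign J 12 (Read (Bin Add (Bin Add (Var 10) (Var 5)) (Bin Mult (Var 11) (Var 6))) (Var 6)))
    (IfNZ 12 (assign J 12 (Bin Add (Var 12) (Read (Var 10) (Var 5)))) Skip)"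

text \<open>A group of \<open>g\<close> consecutive breakpoints. An entry packs the distance to the next breakpoint with
  the slope of \<open>F\<close> up to there, which is 0 or 1, in its lowest bit.\<close>

definition group :: "nat \<Rightarrow> nat \<Rightarrow> nat \<Rightarrow> (nat \<Rightarrow> nat) \<Rightarrow> (nat \<Rightarrow> nat) \<Rightarrow> nat \<Rightarrow> bool list" where
  "group K g e p F \<gamma> = field K (p (\<gamma> * g)) @ field K (F (p (\<gamma> * g))) @
    concat (map (\<lambda>x. field e
      (2 * (p (Suc (\<gamma> * g + x)) - p (\<gamma> * g + x)) + (F (Suc (p (\<gamma> * g + x))) - F (p (\<gamma> * g + x)))))
      [0..<g])"

lemma length_group [simp]: "length (group K g e p F \<gamma>) = K + K + g * e"
  by (simp add: group_def length_concat_const[of _ _ e])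

text \<open>Registers 20 to 24 hold the address of a table, the number of its groups, the number of entries
  of a group, the width of an entry and the size of a group; the argument is in register 25 and the
  result in register 30. The step width of the scan is cut off at the argument, so that the scan
  always runs through a whole group.\<close>

definition search_body :: "nat \<Rightarrow> com" where
  "search_body J =
    Seq (assign J 29 (Bin Divide (Bin Add (Var 26) (Var 27)) (Num 2)))
    (Seq (assign J 30 (Bin Less (Var 25) (Read (Bin Add (Var 20) (Bin Mult (Var 29) (Var 24))) (Var 5))))
    (Seq (IfNZ 30 (assign J 27 (Var 29)) (assign J 26 (Var 29)))
    (assign J 28 (Bin Less (Num 1) (Bin Sub (Var 27) (Var 26))))))"

definition scan_body :: "nat \<Rightarrow> com" where
  "scan_body J =
    Seq (assign J 29 (Read (Var 26) (Var 23)))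
    (Seq (assign J 31 (Bin Divide (Var 29) (Num 2)))
    (Seq (assign J 32 (Bin Less (Bin Sub (Var 25) (Var 27)) (Var 31)))
    (Seq (IfNZ 32 (assign J 31 (Bin Sub (Var 25) (Var 27))) Skip)
    (Seq (assign J 30 (Bin Add (Var 30) (Bin Mult (Var 31) (Bin Modulo (Var 29) (Num 2)))))
    (Seq (assign J 27 (Bin Add (Var 27) (Var 31)))
    (Seq (assign J 26 (Bin Add (Var 26) (Var 23)))
    (assign J 28 (Bin Sub (Var 28) (Num 1)))))))))"

definition rank_com :: "nat \<Rightarrow> com" where
  "rank_com J =
    Seq (assign J 26 (Num 0))
    (Seq (assign J 27 (Var 21))
    (Seq (assign J 28 (Bin Less (Num 1) (Bin Sub (Var 27) (Var 26))))
    (Seq (WhileNZ 28 (search_body J))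
    (Seq (assign J 26 (Bin Add (Var 20) (Bin Mult (Var 26) (Var 24))))
    (Seq (assign J 27 (Read (Var 26) (Var 5)))
    (Seq (assign J 30 (Read (Bin Add (Var 26) (Var 5)) (Var 5)))
    (Seq (assign J 26 (Bin Add (Bin Add (Var 26) (Var 5)) (Var 5)))
    (Seq (assign J 28 (Var 22))
    (WhileNZ 28 (scan_body J))))))))))"

section \<open>Verification of lookup, binary search, scan and rank\<close>

context machine
begin

text \<open>Naming the assigned value \<open>v\<close> keeps states as chains of simple updates; six
  side conditions are discharged before execution continues.\<close>

lemma halts_step:
  assumes "U 4 = w" "0 < N" "x < 100" "wf_exp e" "safe e U" "eval e U = v"
    and "halts N c (U(x := v)) Q"
  shows "halts N (Seq (assign J x e) c) U Q"
  using assms by (intro halts_Seq halts_assign) auto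

text \<open>Merges the two branches of a conditional into a single state \<open>V\<close>.\<close>

lemma halts_cut: "halts N c1 U (\<lambda>U'. U' = V) \<Longrightarrow> halts N c2 V Q \<Longrightarrow> halts N (Seq c1 c2) U Q"
  by (rule halts_Seq, erule halts_mono) simp_all

lemma halts_lookup:
  assumes U: "U 4 = w" "U 5 = K" "U 6 = b" "U 10 = p" "U 11 = j"
    and node: "occurs_at bs p (node K b X q)" and X: "finite X" "card X < 2 ^ K" and "j < b"
    and K: "K + w \<le> J * w" "b \<le> K" and B: "length bs < B" "2 ^ K < B" and N: "0 < N"
    and Q: "Q (U(12 := if q * b + j \<in> X then Suc (card {x \<in> X. x < q * b + j}) else 0))"
  shows "halts N (lookup_com J) U Q"
proof -
  define entry where
    "entry = (\<lambda>j. if q * b + j \<in> X then Suc (card {x \<in> X. q * b \<le> x \<and> x < q * b + j}) else 0)"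
  have "occurs_at bs p (field K (card {x \<in> X. x < q * b}) @
      concat (map (\<lambda>j. field b (entry j)) [0..<b]))"
    using node unfolding node_def entry_def .
  from occurs_at_append[OF this] have o: "occurs_at bs p (field K (card {x \<in> X. x < q * b}))"
    "occurs_at bs (p + K) (concat (map (\<lambda>j. field b (entry j)) [0..<b]))"
    by simp_all
  have "card {x \<in> X. x < q * b} \<le> card X" using X by (intro card_mono) auto
  hence base: "read_bits bs p K = card {x \<in> X. x < q * b}"
    using read_field[OF o(1)] X by simp
  \<comment> \<open>At most \<open>j < b\<close> elements precede within the node, so an entry is at
    most \<open>b\<close>, which is below \<open>2 ^ b\<close>.\<close>
  have "card {x \<in> X. q * b \<le> x \<and> x < q * b + j} \<le> card {q * b..<q * b + j}"
    by (intro card_mono) auto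
  hence "entry j \<le> b" using \<open>j < b\<close> by (auto simp: entry_def)
  hence less: "entry j < 2 ^ b" using less_exp[of b] by (rule le_less_trans)
  have "occurs_at bs (p + K + j * b) (field b (entry j))"
    using occurs_at_concat_upt[OF o(2), of b j] \<open>j < b\<close> by simp
  hence rd: "read_bits bs (p + K + j * b) b = entry j" using less by (rule read_field)
  have "{x \<in> X. x < q * b + j} = {x \<in> X. x < q * b} \<union> {x \<in> X. q * b \<le> x \<and> x < q * b + j}"
    by auto
  moreover have "card ({x \<in> X. x < q * b} \<union> {x \<in> X. q * b \<le> x \<and> x < q * b + j}) =
      card {x \<in> X. x < q * b} + card {x \<in> X. q * b \<le> x \<and> x < q * b + j}"
    by (rule card_Un_disjoint) (use X in auto)
  ultimately have sum: "card {x \<in> X. x < q * b + j} =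
      card {x \<in> X. x < q * b} + card {x \<in> X. q * b \<le> x \<and> x < q * b + j}"
    by simp
  have "j * b + b \<le> b * b" using mult_right_mono[of "Suc j" b b] \<open>j < b\<close> by simp
  hence le: "p + K + j * b \<le> length bs" "b + w \<le> J * w" "p \<le> length bs"
    using occurs_at_le[OF node] K by simp_all
  have "card {x \<in> X. x < q * b + j} \<le> card X" using X by (intro card_mono) auto
  hence *: "Suc (card {x \<in> X. x < q * b + j}) < B" using X B by linarith
  let ?U = "U(12 := entry j)"
  show ?thesis
    unfolding lookup_com_def
  proof (rule halts_step[where v = "entry j"])
    show "halts N (IfNZ 12 (assign J 12 (Bin Add (Var 12) (Read (Var 10) (Var 5)))) Skip) ?U Q"
    proof (rule halts_IfNZ)
      assume "?U 12 \<noteq> 0"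
      hence "q * b + j \<in> X" by (simp add: entry_def split: if_splits)
      hence "entry j = Suc (card {x \<in> X. q * b \<le> x \<and> x < q * b + j})"
        "Q (U(12 := Suc (card {x \<in> X. x < q * b + j})))"
        using Q by (simp_all add: entry_def)
      thus "halts N (assign J 12 (Bin Add (Var 12) (Read (Var 10) (Var 5)))) ?U Q"
        using U le K B N base sum * by (intro halts_assign) (simp_all add: add.commute)
    next
      assume "?U 12 = 0"
      hence "q * b + j \<notin> X" by (simp add: entry_def split: if_splits)
      thus "halts N Skip ?U Q" using Q N by (intro halts_Skip) (simp_all add: entry_def)
    qed (use N in auto)
  qed (use U N le B rd in simp_all)
qed

text \<open>Bisection keeps \<open>P lo \<le> i\<close>, and \<open>i < P hi\<close> unless
  \<open>hi\<close> is the end \<open>G\<close>, where no upper bound is stored. After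
  \<open>h\<close> halvings of an interval of length at most \<open>2 ^ h\<close>, a single group
  remains.\<close>

lemma halts_search:
  assumes U: "U 4 = w" "U 5 = K" "U 20 = a" "U 21 = G" "U 24 = L" "U 25 = i"
    "U 26 = 0" "U 27 = G" "U 28 = (if 1 < G then 1 else 0)"
    and P: "\<And>\<gamma>. \<gamma> < G \<Longrightarrow> read_bits bs (a + \<gamma> * L) K = P \<gamma>" "P 0 \<le> i"
    and G: "0 < G" "G \<le> 2 ^ h" "a + G * L \<le> length bs" "G + G < B"
    and K: "K + w \<le> J * w" and B: "length bs < B" "1 < k * w" and N: "h < N"
    and Q: "\<And>U' \<gamma>. \<gamma> < G \<Longrightarrow> P \<gamma> \<le> i \<Longrightarrow> (Suc \<gamma> < G \<longrightarrow> i < P (Suc \<gamma>)) \<Longrightarrow> U' 26 = \<gamma> \<Longrightarrow>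
      (\<forall>x. x \<notin> {26..30} \<longrightarrow> U' x = U x) \<Longrightarrow> Q U'"
  shows "halts N (WhileNZ 28 (search_body J)) U Q"
proof -
  define Inv where "Inv j U' \<longleftrightarrow> (\<exists>lo hi. U' 26 = lo \<and> U' 27 = hi \<and> lo < hi \<and> hi \<le> G \<and>
    hi - lo \<le> 2 ^ j \<and> P lo \<le> i \<and> (hi < G \<longrightarrow> i < P hi) \<and>
    U' 28 = (if 1 < hi - lo then 1 else 0) \<and> (\<forall>x. x \<notin> {26..30} \<longrightarrow> U' x = U x))" for j U'
  have B2: "2 < B" using B(2) power_strict_increasing[of 1 "k * w" "2::nat"] by simp
  show ?thesis
  proof (rule halts_WhileNZ[where Inv = Inv and j = h])
    show "Inv h U" unfolding Inv_def using U P G by auto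
    fix j U' assume "Inv (Suc j) U'" "U' 28 \<noteq> 0"
    then obtain lo hi where I: "U' 26 = lo" "U' 27 = hi" "hi \<le> G" "hi - lo \<le> 2 ^ Suc j"
      "P lo \<le> i" "hi < G \<longrightarrow> i < P hi" "1 < hi - lo" and fr: "\<And>x. x \<notin> {26..30} \<Longrightarrow> U' x = U x"
      unfolding Inv_def by (auto split: if_splits)
    have U': "U' 4 = w" "U' 5 = K" "U' 20 = a" "U' 24 = L" "U' 25 = i" using fr U by simp_all
    define mid where "mid = (lo + hi) div 2"
    have mid: "lo < mid" "mid < hi" "hi - mid \<le> 2 ^ j" "mid - lo \<le> 2 ^ j"
      using I(4,7) by (auto simp: mid_def)
    have "mid * L \<le> G * L" using mid I(3) by (intro mult_right_mono) auto
    hence addr: "a + mid * L \<le> length bs" using G(3) by linarith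
    have rd: "read_bits bs (a + mid * L) K = P mid" using P(1) mid I(3) by simp
    define c where "c = (if i < P mid then 1 else 0 :: nat)"
    define V where "V = (U'(29 := mid, 30 := c))((if c \<noteq> 0 then 27 else 26) := mid)"
    show "halts 1 (search_body J) U' (Inv j)"
      unfolding search_body_def
      apply (rule halts_step[where v = mid])
            apply (use U' I G B2 in \<open>simp_all add: mid_def\<close>)[6]
      apply (rule halts_step[where v = c])
            apply (use U' addr B K rd in \<open>simp_all add: c_def\<close>)[6]
      apply (rule halts_cut[where V = V])
       apply (rule halts_IfNZ)
          apply simp
         apply simp
        apply (rule halts_assign; use U' in \<open>simp add: V_def\<close>)
       apply (rule halts_assign; use U' in \<open>simp add: V_def\<close>)
      apply (rule halts_assign)
           apply (use U' I mid G B2 in \<open>simp_all add: V_def\<close>)[5]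
      apply (use I mid fr in \<open>auto simp: Inv_def V_def c_def\<close>)[1]
      done
  next
    fix U' assume "Inv 0 U'"
    thus "U' 28 = 0" unfolding Inv_def by auto
  next
    fix j U' assume "Inv j U'" "U' 28 = 0"
    then obtain lo hi where "U' 26 = lo" "U' 27 = hi" "lo < hi" "hi \<le> G" "P lo \<le> i"
      "hi < G \<longrightarrow> i < P hi" "\<not> 1 < hi - lo" "\<forall>x. x \<notin> {26..30} \<longrightarrow> U' x = U x"
      unfolding Inv_def by (auto split: if_splits)
    moreover then have "hi = Suc lo" by linarith
    ultimately show "Q U'" by (intro Q[of lo]) auto
  qed (use N in simp_all)
qed

text \<open>After \<open>t\<close> entries the scan stands at \<open>min i (p t)\<close> and holds
  the value of \<open>F\<close> there. Linearity is required for every partial step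
  \<open>d\<close>, which covers the step that is cut off at \<open>i\<close>.\<close>

lemma halts_scan:
  assumes U: "U 4 = w" "U 23 = e" "U 25 = i" "U 26 = a" "U 27 = p 0" "U 28 = g" "U 30 = F (p 0)"
    and entries: "occurs_at bs a (concat (map (\<lambda>t. field e
      (2 * (p (Suc t) - p t) + (F (Suc (p t)) - F (p t)))) [0..<g]))"
    and p: "\<And>t. p t \<le> p (Suc t)" "p 0 \<le> i" "i \<le> p g"
    and width: "\<And>t. 2 * (p (Suc t) - p t) + 1 < 2 ^ e" "e + w \<le> J * w"
    and F: "\<And>x. F (Suc x) - F x \<le> 1"
      "\<And>t d. d \<le> p (Suc t) - p t \<Longrightarrow> F (p t + d) = F (p t) + d * (F (Suc (p t)) - F (p t))"
      "\<And>x. x \<le> i \<Longrightarrow> F x < B"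
    and B: "length bs < B" "i < B" "g < B" "1 < k * w" and N: "g < N"
    and Q: "\<And>U'. U' 30 = F i \<Longrightarrow> (\<forall>x. x \<notin> {26..32} \<longrightarrow> U' x = U x) \<Longrightarrow> Q U'"
  shows "halts N (WhileNZ 28 (scan_body J)) U Q"
proof -
  define Inv where "Inv j U' \<longleftrightarrow> j \<le> g \<and> U' 28 = j \<and> U' 27 = min i (p (g - j)) \<and>
    U' 30 = F (min i (p (g - j))) \<and> U' 26 = a + (g - j) * e \<and>
    (\<forall>x. x \<notin> {26..32} \<longrightarrow> U' x = U x)" for j U'
  have B2: "2 < B" using B(4) power_strict_increasing[of 1 "k * w" "2::nat"] by simp
  show ?thesis
  proof (rule halts_WhileNZ[where Inv = Inv and j = g])
    show "Inv g U" unfolding Inv_def using U p by (auto simp: min_absorb2)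
    fix j U' assume I: "Inv (Suc j) U'"
    define t where "t = g - Suc j"
    have t: "t < g" "g - j = Suc t" "Suc j \<le> g" using I by (auto simp: Inv_def t_def)
    define gap sl where "gap = p (Suc t) - p t" and "sl = F (Suc (p t)) - F (p t)"
    define pos where "pos = min i (p t)"
    have fr: "\<And>x. x \<notin> {26..32} \<Longrightarrow> U' x = U x" and U': "U' 4 = w" "U' 23 = e" "U' 25 = i"
      "U' 28 = Suc j" "U' 27 = pos" "U' 30 = F pos" "U' 26 = a + t * e"
      using I U unfolding Inv_def t_def[symmetric] pos_def by simp_all
    have sl: "sl \<le> 1" using F(1) by (simp add: sl_def)
    have v: "2 * gap + sl < 2 ^ e" using width(1)[of t] sl by (simp add: gap_def)
    have "occurs_at bs (a + t * e) (field e (2 * gap + sl))"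
      unfolding gap_def sl_def by (rule occurs_at_concat_upt[OF entries _ t(1)]) simp
    hence rd: "read_bits bs (a + t * e) e = 2 * gap + sl" and addr: "a + t * e + e \<le> length bs"
      using read_field v occurs_at_le by fastforce+
    have vd: "(2 * gap + sl) div 2 = gap" "(2 * gap + sl) mod 2 = sl" using sl by auto
    \<comment> \<open>The distance to \<open>min i (p (Suc t))\<close>. It is 0 once
      \<open>i\<close> has been reached, so that later entries change nothing.\<close>
    define d where "d = (if i - pos < gap then i - pos else gap)"
    have d: "pos + d = min i (p (Suc t))" "F (pos + d) = F pos + d * sl"
      using p(1)[of t] F(2)[of d t] by (auto simp: d_def pos_def gap_def sl_def min_def split: if_splits)
    have le: "pos \<le> i" "pos + d \<le> i" "F (pos + d) < B" "d * sl \<le> F (pos + d)"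
      using d F(3)[of "pos + d"] by (auto simp: pos_def)
    define c where "c = (if i - pos < gap then 1 else 0 :: nat)"
    show "halts 1 (scan_body J) U' (Inv j)"
      unfolding scan_body_def
      apply (rule halts_step[where v = "2 * gap + sl"])
            apply (use U' addr width rd in simp_all)[6]
      apply (rule halts_step[where v = gap])
            apply (use U' B2 vd in simp_all)[6]
      apply (rule halts_step[where v = c])
            apply (use U' le B in \<open>simp_all add: c_def\<close>)[6]
      apply (rule halts_cut[where V = "U'(29 := 2 * gap + sl, 31 := d, 32 := c)"])
       apply (rule halts_IfNZ)
          apply simp
         apply simp
        apply (rule halts_assign)
             apply (use U' le B in \<open>auto simp: c_def d_def split: if_splits\<close>)[6]
       apply (rule halts_Skip)
        apply simp
       apply (simp add: c_def d_def split: if_splits)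
      apply (rule halts_step[where v = "F pos + d * sl"])
            apply (use U' le d B2 vd in simp_all)[6]
      apply (rule halts_step[where v = "pos + d"])
            apply (use U' le B in simp_all)[6]
      apply (rule halts_step[where v = "a + t * e + e"])
            apply (use U' addr B in simp_all)[6]
      apply (rule halts_assign)
           apply (use U' t B B2 in simp_all)[5]
      apply (use U' d t fr in \<open>simp add: Inv_def\<close>)
      done
  next
    fix U' assume "Inv 0 U'"
    thus "U' 28 = 0" unfolding Inv_def by auto
  next
    fix j U' assume "Inv j U'" "U' 28 = 0"
    thus "Q U'" using p(3) by (intro Q) (auto simp: Inv_def min_absorb1)
  qed (use N in simp_all)
qed

lemma halts_rank:
  assumes U: "U 4 = w" "U 5 = K" "U 20 = a" "U 21 = G" "U 22 = g" "U 23 = e"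
    "U 24 = K + K + g * e" "U 25 = i"
    and tab: "occurs_at bs a (concat (map (group K g e p F) [0..<G]))"
    and p: "\<And>t. p t \<le> p (Suc t)" "p 0 \<le> i" "i \<le> p (G * g)" "\<And>t. p t < 2 ^ K"
    and G: "0 < G" "G \<le> 2 ^ h"
    and width: "\<And>t. 2 * (p (Suc t) - p t) + 1 < 2 ^ e" "e \<le> K" "K + w \<le> J * w" "0 < K"
    and F: "\<And>x. F (Suc x) - F x \<le> 1"
      "\<And>t d. d \<le> p (Suc t) - p t \<Longrightarrow> F (p t + d) = F (p t) + d * (F (Suc (p t)) - F (p t))"
      "\<And>x. x \<le> i \<Longrightarrow> F x < 2 ^ K"
    and B: "length bs < 2 ^ K" "2 ^ K < B" "i < 2 ^ K" "g < 2 ^ K" and N: "h < N" "g < N"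
    and Q: "\<And>U'. U' 30 = F i \<Longrightarrow> (\<forall>x. x \<notin> {26..32} \<longrightarrow> U' x = U x) \<Longrightarrow> Q U'"
  shows "halts N (rank_com J) U Q"
proof -
  define L where "L = K + K + g * e"
  have gr: "occurs_at bs (a + \<gamma> * L) (group K g e p F \<gamma>)" if "\<gamma> < G" for \<gamma>
    by (rule occurs_at_concat_upt[OF tab _ that]) (simp add: L_def)
  have rd: "read_bits bs (a + \<gamma> * L) K = p (\<gamma> * g)" if "\<gamma> < G" for \<gamma>
    using occurs_at_append[OF gr[OF that, unfolded group_def]] read_field p(4) by blast
  have "length (concat (map (group K g e p F) [0..<G])) = G * L"
    by (subst length_concat_const[of _ _ L]) (simp_all add: L_def)
  with occurs_at_le[OF tab] have len: "a + G * L \<le> length bs" by simp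
  \<comment> \<open>A group takes at least two bits, so \<open>G + G\<close>, which bounds
    \<open>lo + hi\<close> in the search, does not wrap.\<close>
  have "G * 2 \<le> G * L"
    by (rule mult_le_mono2) (use width(4) in \<open>simp add: L_def\<close>)
  hence GG: "G + G < B" using len B by linarith
  have kw: "1 < k * w"
  proof (rule ccontr)
    assume "\<not> 1 < k * w"
    hence "B \<le> 2 ^ 1" by (intro power_increasing) auto
    moreover have "(2::nat) ^ 1 \<le> 2 ^ K" using width(4) by (intro power_increasing) auto
    ultimately show False using B(2) by linarith
  qed
  have N0: "0 < N" using N by simp
  have B': "length bs < B" "i < B" "g < B" using B by linarith+
  have B1: "Suc 0 < B" using less_trans[OF kw less_exp] by simp
  have FB: "F x < B" if "x \<le> i" for x using F(3)[OF that] B(2) by linarith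
  have eJ: "e + w \<le> J * w" using width by linarith
  show ?thesis
    unfolding rank_com_def
    apply (rule halts_step[where v = 0])
          apply (use U N0 in simp_all)[6]
    apply (rule halts_step[where v = G])
          apply (use U N0 in simp_all)[6]
    apply (rule halts_step[where v = "if 1 < G then 1 else 0"])
          apply (use U N0 GG B1 in simp_all)[6]
    apply (rule halts_Seq)
    apply (rule halts_search[where P = "\<lambda>\<gamma>. p (\<gamma> * g)" and K = K and a = a and G = G and L = L
          and i = i and h = h])
                        apply (use U L_def rd p(2) G len GG width B' kw N in simp_all)[19]
  proof -
    fix V \<gamma>
    assume \<gamma>: "\<gamma> < G" "p (\<gamma> * g) \<le> i" "Suc \<gamma> < G \<longrightarrow> i < p (Suc \<gamma> * g)" "V 26 = \<gamma>"
      and V_fr: "\<forall>x. x \<notin> {26..30} \<longrightarrow>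
        V x = (U(26 := 0, 27 := G, 28 := if 1 < G then 1 else 0)) x"
    have fr: "V x = U x" if "x \<notin> {26..30}" for x using V_fr that by auto
    have V: "V 4 = w" "V 5 = K" "V 20 = a" "V 22 = g" "V 23 = e" "V 24 = L" "V 25 = i"
      using fr U L_def by simp_all
    define A where "A = a + \<gamma> * L"
    have "\<gamma> * L \<le> G * L" using \<gamma>(1) by (intro mult_right_mono) auto
    hence "\<gamma> * L < B" using len B by linarith
    note o = conjunct2[OF occurs_at_append[OF gr[OF \<gamma>(1), folded A_def, unfolded group_def]]]
    have o2: "occurs_at bs (A + K) (field K (F (p (\<gamma> * g))))"
      "occurs_at bs (A + K + K) (concat (map (\<lambda>x. field e
        (2 * (p (\<gamma> * g + Suc x) - p (\<gamma> * g + x)) + (F (Suc (p (\<gamma> * g + x))) - F (p (\<gamma> * g + x)))))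
        [0..<g]))"
      using occurs_at_append[OF o] by simp_all
    have rd2: "read_bits bs (A + K) K = F (p (\<gamma> * g))" "read_bits bs A K = p (\<gamma> * g)"
      using read_field[OF o2(1)] F(3)[OF \<gamma>(2)] rd[OF \<gamma>(1)] by (simp_all add: A_def)
    have le: "A + K + K \<le> length bs" using occurs_at_le[OF o2(2)] by simp
    \<comment> \<open>\<open>i\<close> lies before the next group if there is one, and otherwise not
      beyond the end of the last group.\<close>
    have last: "i \<le> p (\<gamma> * g + g)"
      using \<gamma>(1,3) p(3) by (cases "Suc \<gamma> < G") (auto simp: less_Suc_eq add.commute not_less le_Suc_eq)
    show "halts N
       (Seq (assign J 26 (Bin Add (Var 20) (Bin Mult (Var 26) (Var 24))))
         (Seq (assign J 27 (Read (Var 26) (Var 5)))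
         (Seq (assign J 30 (Read (Bin Add (Var 26) (Var 5)) (Var 5)))
         (Seq (assign J 26 (Bin Add (Bin Add (Var 26) (Var 5)) (Var 5)))
         (Seq (assign J 28 (Var 22)) (WhileNZ 28 (scan_body J))))))) V Q"
      apply (rule halts_step[where v = A])
            apply (use V \<gamma> N0 le B' \<open>\<gamma> * L < B\<close> in \<open>simp_all add: A_def\<close>)[6]
      apply (rule halts_step[where v = "p (\<gamma> * g)"])
            apply (use V \<gamma> N0 le B' width rd2 in simp_all)[6]
      apply (rule halts_step[where v = "F (p (\<gamma> * g))"])
            apply (use V \<gamma> N0 le B' width rd2 in simp_all)[6]
      apply (rule halts_step[where v = "A + K + K"])
            apply (use V \<gamma> N0 le B' width rd2 in simp_all)[6]
      apply (rule halts_step[where v = g])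
            apply (use V N0 in simp_all)[6]
      apply (rule halts_scan[where p = "\<lambda>t. p (\<gamma> * g + t)" and F = F and a = "A + K + K"
            and g = g and e = e and i = i])
                          apply (use V in simp_all)[7]
                   apply (use o2 in simp)
                  apply (use p \<gamma> last width eJ F FB B' kw N in simp_all)[13]
    proof -
      fix U'
      assume U': "U' 30 = F i" "\<forall>x. x \<notin> {26..32} \<longrightarrow>
        U' x = (V(26 := A, 27 := p (\<gamma> * g), 30 := F (p (\<gamma> * g)), 26 := A + K + K, 28 := g)) x"
      have "U' x = U x" if "x \<notin> {26..32}" for x
      proof -
        have "U' x = V x" using U'(2) that by auto
        thus ?thesis using fr[of x] that by auto
      qed
      thus "Q U'" using U'(1) by (intro Q) auto
    qed
  qed
qed

end

section \<open>Runs\<close>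

lemma runsD:
  assumes "(i, j) \<in> runs L"
  shows "i \<le> j" "j < length L" "i \<le> k \<Longrightarrow> k \<le> j \<Longrightarrow> L ! k = L ! i"
    "j + 1 < length L \<Longrightarrow> L ! (j + 1) \<noteq> L ! j"
proof -
  have *: "i \<le> j \<and> j < length L \<and> (\<forall>k\<in>{i..j}. L ! k = L ! i) \<and>
      (0 < i \<longrightarrow> L ! (i - 1) \<noteq> L ! i) \<and> (j + 1 < length L \<longrightarrow> L ! (j + 1) \<noteq> L ! j)"
    using assms unfolding runs_def mem_Collect_eq prod.case .
  thus "i \<le> j" "j < length L" "j + 1 < length L \<Longrightarrow> L ! (j + 1) \<noteq> L ! j" by blast+
  from * show "L ! k = L ! i" if "i \<le> k" "k \<le> j" using that
    unfolding Ball_def atLeastAtMost_iff by blast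
qed

lemma runs_fst_less: "(i, j) \<in> runs L \<Longrightarrow> i < length L"
  using runsD(1,2) by (meson le_less_trans)

lemma runsI:
  assumes "i \<le> j" "j < length L" "\<And>k. i \<le> k \<Longrightarrow> k \<le> j \<Longrightarrow> L ! k = L ! i"
    and "0 < i \<Longrightarrow> L ! (i - 1) \<noteq> L ! i" "j + 1 < length L \<Longrightarrow> L ! (j + 1) \<noteq> L ! j"
  shows "(i, j) \<in> runs L"
  unfolding runs_def mem_Collect_eq prod.case Ball_def atLeastAtMost_iff
  using assms by blast

lemma finite_runs: "finite (runs L)"
proof (rule finite_subset)
  show "runs L \<subseteq> {..<length L} \<times> {..<length L}"
  proof
    fix x assume "x \<in> runs L"
    then obtain i j where "x = (i, j)" "i \<le> j" "j < length L" using runsD by (metis prod.collapse)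
    thus "x \<in> {..<length L} \<times> {..<length L}" by simp
  qed
qed simp

lemma run_starting_at:
  assumes "i < length L" "i = 0 \<or> L ! (i - 1) \<noteq> L ! i"
  shows "\<exists>j. (i, j) \<in> runs L"
proof -
  define same where "same j \<longleftrightarrow> (\<forall>k. i \<le> k \<longrightarrow> k \<le> j \<longrightarrow> L ! k = L ! i)" for j
  have "same i" unfolding same_def using le_antisym by blast
  hence "\<exists>j. (i \<le> j \<and> j < length L \<and> same j) \<and> (\<forall>y. i \<le> y \<and> y < length L \<and> same y \<longrightarrow> y \<le> j)"
    using assms(1) by (intro Nat.ex_has_greatest_nat[of _ i "length L"]) auto
  then obtain z where z: "i \<le> z" "z < length L" "same z"
    and max: "\<And>y. i \<le> y \<Longrightarrow> y < length L \<Longrightarrow> same y \<Longrightarrow> y \<le> z" by blast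
  have "(i, z) \<in> runs L"
  proof (rule runsI)
    show "L ! (z + 1) \<noteq> L ! z" if "z + 1 < length L"
    proof
      assume eq: "L ! (z + 1) = L ! z"
      have "same (z + 1)"
        unfolding same_def
      proof (intro allI impI)
        fix k assume "i \<le> k" "k \<le> z + 1"
        moreover have "L ! z = L ! i" using z unfolding same_def by blast
        ultimately show "L ! k = L ! i"
          using z(3) eq unfolding same_def by (metis Suc_eq_plus1 le_SucE)
      qed
      from max[OF _ that this] z(1) show False by simp
    qed
  qed (use z assms same_def in blast)+
  thus ?thesis ..
qed

lemma run_ending_at:
  assumes "j < length L" "Suc j < length L \<Longrightarrow> L ! Suc j \<noteq> L ! j"
  shows "\<exists>i. (i, j) \<in> runs L \<and> L ! i = L ! j"
proof -
  define same where "same i \<longleftrightarrow> (\<forall>k. i \<le> k \<longrightarrow> k \<le> j \<longrightarrow> L ! k = L ! j)" for i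
  have "same j" unfolding same_def using le_antisym by blast
  then obtain i where i: "i \<le> j" "same i" and least: "\<And>y. y \<le> j \<Longrightarrow> same y \<Longrightarrow> i \<le> y"
    using LeastI[of "\<lambda>i. i \<le> j \<and> same i" j] Least_le[of "\<lambda>i. i \<le> j \<and> same i"] by blast
  have ij: "L ! i = L ! j" using i unfolding same_def by blast
  have "(i, j) \<in> runs L"
  proof (rule runsI)
    show "L ! (i - 1) \<noteq> L ! i" if "0 < i"
    proof
      assume eq: "L ! (i - 1) = L ! i"
      have "same (i - 1)"
        unfolding same_def
      proof (intro allI impI)
        fix k assume "i - 1 \<le> k" "k \<le> j"
        show "L ! k = L ! j"
        proof (cases "k = i - 1")
          case True
          with eq ij show ?thesis by metis
        next
          case False
          hence "i \<le> k" using \<open>i - 1 \<le> k\<close> by linarith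
          thus ?thesis using \<open>k \<le> j\<close> i(2) unfolding same_def by blast
        qed
      qed
      moreover have "i - 1 \<le> j" using i(1) by linarith
      ultimately have "i \<le> i - 1" by (rule least[rotated])
      with that show False by simp
    qed
    show "L ! k = L ! i" if "i \<le> k" "k \<le> j" for k
      using that i(2) ij unfolding same_def by metis
  qed (use i assms in auto)
  with ij show ?thesis by blast
qed

text \<open>Of two runs with the same start, the shorter one would not be maximal.\<close>

lemma inj_on_fst_runs: "inj_on fst (runs L)"
proof (rule inj_onI)
  fix x y assume "x \<in> runs L" "y \<in> runs L" "fst x = fst y"
  then obtain i j j' where xy: "x = (i, j)" "y = (i, j')" "(i, j) \<in> runs L" "(i, j') \<in> runs L"
    by (metis prod.collapse)
  have "\<not> j < j'" if run: "(i, j) \<in> runs L" "(i, j') \<in> runs L" for j j'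
  proof
    assume "j < j'"
    hence "L ! (j + 1) = L ! i" "L ! j = L ! i" "j + 1 < length L"
      using runsD(1,2)[OF run(1)] runsD(2)[OF run(2)] runsD(3)[OF run(2), of "j + 1"]
        runsD(3)[OF run(2), of j] by linarith+
    thus False using runsD(4)[OF run(1)] by metis
  qed
  with xy show "x = y" by (metis linorder_neqE_nat)
qed

lemma finite_runs_of: "finite {(i, j) \<in> runs L. L ! i = a}"
  by (rule finite_subset[OF _ finite_runs]) auto

lemma num_runs_of_le_length: "num_runs_of a L \<le> length L"
proof -
  have "card (fst ` {(i, j) \<in> runs L. L ! i = a}) \<le> card {..<length L}"
    by (intro card_mono) (auto dest: runs_fst_less)
  moreover have "inj_on fst {(i, j) \<in> runs L. L ! i = a}"
    by (rule inj_on_subset[OF inj_on_fst_runs]) auto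
  ultimately show ?thesis by (simp add: num_runs_of_def card_image)
qed

lemma sum_num_runs_of: "(\<Sum>a\<in>set L. num_runs_of a L) = num_runs L"
proof -
  have "runs L = (\<Union>a\<in>set L. {(i, j) \<in> runs L. L ! i = a})"
    by (auto intro!: nth_mem dest: runs_fst_less)
  hence "num_runs L = card (\<Union>a\<in>set L. {(i, j) \<in> runs L. L ! i = a})"
    by (simp add: num_runs_def)
  also have "\<dots> = (\<Sum>a\<in>set L. num_runs_of a L)"
    unfolding num_runs_of_def
    by (rule card_UN_disjoint) (use finite_runs_of in auto)
  finally show ?thesis ..
qed

text \<open>The first occurrence of \<open>a\<close> starts a run.\<close>

lemma num_runs_of_pos:
  assumes "a \<in> set L"
  shows "0 < num_runs_of a L"
proof -
  let ?P = "\<lambda>i. i < length L \<and> L ! i = a"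
  obtain i0 where "?P i0" using assms by (auto simp: in_set_conv_nth)
  then obtain i where i: "?P i" and least: "\<And>y. ?P y \<Longrightarrow> i \<le> y"
    using LeastI[of ?P i0] Least_le[of ?P] by blast
  have "i = 0 \<or> L ! (i - 1) \<noteq> L ! i" 
  proof (rule disjCI)
    assume "\<not> L ! (i - 1) \<noteq> L ! i"
    with i have "?P (i - 1)" by (simp add: less_imp_diff_less)
    from least[OF this] show "i = 0" by linarith
  qed
  then obtain j where "(i, j) \<in> runs L" using run_starting_at i by blast
  hence "(i, j) \<in> {(i, j) \<in> runs L. L ! i = a}" using i by simp
  hence "{(i, j) \<in> runs L. L ! i = a} \<noteq> {}" by blast
  with finite_runs_of[of L a] have "0 < card {(i, j) \<in> runs L. L ! i = a}" unfolding card_gt_0_iff by (rule conjI[rotated])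
  thus ?thesis unfolding num_runs_of_def .
qed

text \<open>Each such position is either the start of a run of \<open>a\<close> or the position
  right after the end of one.\<close>

lemma card_run_boundaries:
  "card {j. 0 < j \<and> j < length L \<and> (L ! j = a) \<noteq> (L ! (j - 1) = a)} \<le> 2 * num_runs_of a L"
proof -
  let ?R = "{(i, j) \<in> runs L. L ! i = a}"
  have "{j. 0 < j \<and> j < length L \<and> (L ! j = a) \<noteq> (L ! (j - 1) = a)} \<subseteq> fst ` ?R \<union> (Suc \<circ> snd) ` ?R"
  proof
    fix j assume j: "j \<in> {j. 0 < j \<and> j < length L \<and> (L ! j = a) \<noteq> (L ! (j - 1) = a)}"
    show "j \<in> fst ` ?R \<union> (Suc \<circ> snd) ` ?R"
    proof (cases "L ! j = a")
      case True
      then obtain j' where "(j, j') \<in> runs L" using run_starting_at[of j L] j by auto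
      with True show ?thesis by force
    next
      case False
      have j': "j = Suc (j - 1)" "j - 1 < length L" using j by (auto simp: less_imp_diff_less)
      have "L ! Suc (j - 1) \<noteq> L ! (j - 1)" using False j j'(1) by auto
      then obtain i where "(i, j - 1) \<in> runs L" "L ! i = a"
        using run_ending_at[OF j'(2)] False j by auto
      moreover note j'(1)
      ultimately show ?thesis by force
    qed
  qed
  hence "card {j. 0 < j \<and> j < length L \<and> (L ! j = a) \<noteq> (L ! (j - 1) = a)}
      \<le> card (fst ` ?R \<union> (Suc \<circ> snd) ` ?R)"
    by (rule card_mono[rotated]) (use finite_runs_of in auto)
  also have "\<dots> \<le> card (fst ` ?R) + card ((Suc \<circ> snd) ` ?R)" by (rule card_Un_le)
  also have "\<dots> \<le> card ?R + card ?R" by (intro add_mono card_image_le finite_runs_of)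
  finally show ?thesis by (simp add: num_runs_of_def)
qed

text \<open>Links the rank delivered by a lookup to the place of the element in an array stored in
  sorted order.\<close>

lemma nth_sorted_list_of_set_card_less:
  fixes X :: "'a :: linorder set"
  assumes "finite X" "x \<in> X"
  shows "sorted_list_of_set X ! card {y \<in> X. y < x} = x" "card {y \<in> X. y < x} < card X"
proof -
  let ?xs = "sorted_list_of_set X"
  have ss: "?xs ! i < ?xs ! j \<longleftrightarrow> i < j" if "i < length ?xs" "j < length ?xs" for i j
    using strict_sorted_list_of_set[of X] that
    by (metis linorder_neqE_nat order_less_asym sorted_wrt_iff_nth_less order_less_irrefl)
  obtain i where i: "i < length ?xs" "?xs ! i = x"
    using assms by (metis in_set_conv_nth set_sorted_list_of_set)
  have X: "X = set ?xs" using assms by simp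
  have "{y \<in> X. y < x} = (!) ?xs ` {..<i}"
  proof (intro set_eqI iffI)
    fix y assume "y \<in> {y \<in> X. y < x}"
    then obtain j where "j < length ?xs" "?xs ! j = y" "y < x"
      using X by (metis (mono_tags, lifting) in_set_conv_nth mem_Collect_eq)
    with ss[of j i] i show "y \<in> (!) ?xs ` {..<i}" by blast
  next
    fix y assume "y \<in> (!) ?xs ` {..<i}"
    then obtain j where j: "j < i" "y = ?xs ! j" by blast
    hence "y < x" using ss[of j i] i by simp
    moreover have "y \<in> X" using j i X nth_mem[of j ?xs] by (simp del: length_sorted_list_of_set)
    ultimately show "y \<in> {y \<in> X. y < x}" by simp
  qed
  moreover have "inj_on ((!) ?xs) {..<i}"
    using i(1) by (intro inj_onI) (simp add: nth_eq_iff_index_eq)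
  ultimately have "card {y \<in> X. y < x} = i" by (simp add: card_image)
  thus "?xs ! card {y \<in> X. y < x} = x" "card {y \<in> X. y < x} < card X" using i by simp_all
qed

section \<open>Breakpoints\<close>

context bw_text
begin

abbreviation "r a \<equiv> num_runs_of a L"

text \<open>A power of two between half of \<open>n div r a\<close> and \<open>n div r a\<close>:
  small enough for the entry width and large enough to yield only \<open>O(r a)\<close>
  multiples.\<close>

definition stride :: "nat \<Rightarrow> nat" where
  "stride a = 2 ^ floor_log (n div r a)"

text \<open>The function \<open>lf a\<close> is linear between consecutive breakpoints. The multiples of the stride
  bound the distance of consecutive breakpoints by \<open>n / r a\<close>, and there are only \<open>O(r a)\<close> of them.\<close>

definition breakpoints :: "nat \<Rightarrow> nat set" where
  "breakpoints a = {j. j < n \<and> (stride a dvd j \<or> (L ! j = a) \<noteq> (L ! (j - 1) = a))}"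

text \<open>The value \<open>n\<close> past the last breakpoint closes the last linear piece and
  pads the last group with gaps of 0.\<close>

definition point :: "nat \<Rightarrow> nat \<Rightarrow> nat" where
  "point a t = (if t < card (breakpoints a) then sorted_list_of_set (breakpoints a) ! t else n)"

lemma finite_breakpoints [simp]: "finite (breakpoints a)"
  by (rule finite_subset[of _ "{..<n}"]) (auto simp: breakpoints_def)

lemma point_in: "t < card (breakpoints a) \<Longrightarrow> point a t \<in> breakpoints a"
  using nth_mem[of t "sorted_list_of_set (breakpoints a)"] by (simp add: point_def)

lemma point_le_n: "point a t \<le> n"
  using point_in[of t a] by (cases "t < card (breakpoints a)") (auto simp: breakpoints_def point_def)

lemma point_less:
  assumes "t < u" "u < card (breakpoints a)"
  shows "point a t < point a u"
  using sorted_wrt_nth_less[OF strict_sorted_list_of_set[of "breakpoints a"], of t u] assms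
  by (simp add: point_def)

lemma point_Suc_ge: "point a t \<le> point a (Suc t)"
  using point_less[of t "Suc t" a] point_le_n[of a t]
  by (cases "Suc t < card (breakpoints a)") (auto simp: point_def)

lemma breakpoint_eq_point:
  assumes "y \<in> breakpoints a"
  obtains u where "u < card (breakpoints a)" "y = point a u"
proof -
  have "y \<in> set (sorted_list_of_set (breakpoints a))" using assms by simp
  then obtain u where "u < card (breakpoints a)" "sorted_list_of_set (breakpoints a) ! u = y"
    by (metis in_set_conv_nth length_sorted_list_of_set)
  thus ?thesis by (intro that[of u]) (simp_all add: point_def)
qed

lemma point_Suc_le:
  assumes "y \<in> breakpoints a" "point a t < y"
  shows "point a (Suc t) \<le> y"
proof -
  obtain u where u: "u < card (breakpoints a)" "y = point a u"
    using breakpoint_eq_point[OF assms(1)] .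
  have "t < u"
  proof (rule ccontr)
    assume "\<not> t < u"
    hence "u \<le> t" by simp
    hence "point a u \<le> point a t" using lift_Suc_mono_le[of "point a", OF point_Suc_ge] by simp
    with u assms show False by simp
  qed
  hence "point a (Suc t) \<le> point a u"
    using lift_Suc_mono_le[of "point a" "Suc t" u, OF point_Suc_ge] by simp
  with u show ?thesis by simp
qed

lemma point_0: "point a 0 = 0"
proof -
  have "0 \<in> breakpoints a" using length_ge_2 by (auto simp: breakpoints_def)
  then obtain u where u: "0 = point a u" by (rule breakpoint_eq_point)
  have "point a 0 \<le> point a u" using lift_Suc_mono_le[of "point a" 0 u, OF point_Suc_ge] by simp
  with u show ?thesis by simp
qed

lemma point_end: "card (breakpoints a) \<le> t \<Longrightarrow> point a t = n"
  by (simp add: point_def)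

text \<open>The next multiple of the stride is itself a breakpoint, unless it lies at or beyond
  \<open>n\<close>.\<close>

lemma point_gap: "point a (Suc t) - point a t \<le> stride a"
proof -
  let ?S = "stride a" and ?x = "point a t"
  have S: "0 < ?S" by (simp add: stride_def)
  define y where "y = (?x div ?S + 1) * ?S"
  have y: "?x < y" "y \<le> ?x + ?S"
    using S dividend_less_div_times[OF S, of ?x] div_times_less_eq_dividend[of ?x ?S] by (auto simp: y_def)
  have "point a (Suc t) \<le> y"
  proof (cases "y < n")
    case True
    have "?S dvd y" unfolding y_def by (rule dvd_triv_right)
    with True have "y \<in> breakpoints a" unfolding breakpoints_def by blast
    thus ?thesis using y(1) by (rule point_Suc_le)
  next
    case False
    with point_le_n[of a "Suc t"] show ?thesis by linarith
  qed
  with y show ?thesis by linarith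
qed

lemma L_between_points:
  assumes "point a t + d < point a (Suc t)"
  shows "(L ! (point a t + d) = a) = (L ! point a t = a)"
  using assms
proof (induction d)
  case (Suc d)
  let ?j = "point a t + Suc d"
  have "?j \<notin> breakpoints a"
  proof
    assume "?j \<in> breakpoints a"
    hence "point a (Suc t) \<le> ?j" by (rule point_Suc_le) simp
    with Suc.prems show False by simp
  qed
  moreover have "?j < n" using Suc.prems point_le_n[of a "Suc t"] by linarith
  ultimately have "(L ! ?j = a) = (L ! (?j - 1) = a)" unfolding breakpoints_def by blast
  with Suc show ?case by simp
qed simp

lemma lf_slope: "lf a (Suc x) - lf a x \<le> 1"
  by (simp add: lf_Suc)

text \<open>The increment of \<open>lf a\<close> at \<open>j\<close> is 1 or 0 according to
  \<open>L ! j = a\<close>, which does not change between breakpoints.\<close>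

lemma lf_linear:
  assumes "d \<le> point a (Suc t) - point a t"
  shows "lf a (point a t + d) =
    lf a (point a t) + d * (lf a (Suc (point a t)) - lf a (point a t))"
  using assms
proof (induction d)
  case (Suc d)
  have "point a t + d < point a (Suc t)" using Suc.prems by linarith
  from L_between_points[OF this] Suc show ?case by (simp add: lf_Suc)
qed simp

lemma card_breakpoints:
  assumes "a \<in> set L"
  shows "card (breakpoints a) \<le> 4 * r a"
proof -
  let ?S = "stride a"
  have S: "0 < ?S" by (simp add: stride_def)
  have r: "0 < r a" using num_runs_of_pos[OF assms] .
  \<comment> \<open>As the stride exceeds half of \<open>n div r a\<close>, the quotient
    \<open>n div ?S\<close> is strictly below \<open>2 * r a\<close>; strictness makes room for the
    multiple 0.\<close>
  have "n div r a < 2 * ?S" unfolding stride_def by (rule floor_log_exp2_gt)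
  hence "n < 2 * ?S * r a" using r by (simp add: div_less_iff_less_mult)
  hence div: "n div ?S < 2 * r a" using S by (simp add: div_less_iff_less_mult mult_ac)
  have "{j. j < n \<and> ?S dvd j} \<subseteq> (\<lambda>i. i * ?S) ` {..n div ?S}"
  proof
    fix j assume "j \<in> {j. j < n \<and> ?S dvd j}"
    hence "j = (j div ?S) * ?S" "j div ?S \<le> n div ?S" by (auto intro: div_le_mono)
    thus "j \<in> (\<lambda>i. i * ?S) ` {..n div ?S}" by blast
  qed
  hence "card {j. j < n \<and> ?S dvd j} \<le> card ((\<lambda>i. i * ?S) ` {..n div ?S})" by (rule card_mono[rotated]) simp
  also have "\<dots> \<le> card {..n div ?S}" by (rule card_image_le) simp
  finally have 1: "card {j. j < n \<and> ?S dvd j} \<le> 2 * r a" using div by simp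
  have "breakpoints a \<subseteq> {j. j < n \<and> ?S dvd j} \<union>
      {j. 0 < j \<and> j < length L \<and> (L ! j = a) \<noteq> (L ! (j - 1) = a)}"
  proof
    fix j assume "j \<in> breakpoints a"
    thus "j \<in> {j. j < n \<and> ?S dvd j} \<union>
      {j. 0 < j \<and> j < length L \<and> (L ! j = a) \<noteq> (L ! (j - 1) = a)}"
      unfolding breakpoints_def by (cases "j = 0") auto
  qed
  hence "card (breakpoints a) \<le> card ({j. j < n \<and> ?S dvd j} \<union>
      {j. 0 < j \<and> j < length L \<and> (L ! j = a) \<noteq> (L ! (j - 1) = a)})"
    by (rule card_mono[rotated]) simp
  also have "\<dots> \<le> card {j. j < n \<and> ?S dvd j} +
      card {j. 0 < j \<and> j < length L \<and> (L ! j = a) \<noteq> (L ! (j - 1) = a)}" by (rule card_Un_le)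
  finally show ?thesis using 1 card_run_boundaries[of L a] by linarith
qed

lemma card_breakpoints_le_n: "card (breakpoints a) \<le> n"
proof -
  have "card (breakpoints a) \<le> card {..<n}" by (rule card_mono) (auto simp: breakpoints_def)
  thus ?thesis by simp
qed

end

section \<open>The data structure\<close>

text \<open>The transform treats the text as cyclic: for the terminator, the LF mapping would report an
  occurrence whenever \<open>P\<close> is a prefix of the text. The true answer is nonempty only for \<open>P = []\<close>,
  which is recognised by its interval being the whole suffix array.\<close>

definition terminator_com :: "nat \<Rightarrow> com" where
  "terminator_com J =
    Seq (assign J 9 (Bin Mult (Bin Equal (Var 2) (Num 0)) (Bin Equal (Bin Add (Var 3) (Num 1)) (Var 7))))
    (IfNZ 9 (assign J 3 (Num 0)) (assign J 1 (Num 0)))"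

text \<open>Two rank computations, at \<open>s\<close> and at \<open>e + 1\<close>. Register 15
  keeps the first result, because \<open>rank_com\<close> changes only registers 26 to 32.\<close>

definition table_com :: "nat \<Rightarrow> com" where
  "table_com J =
    Seq (assign J 20 (Read (Var 10) (Var 5)))
    (Seq (assign J 21 (Read (Bin Add (Var 10) (Var 5)) (Var 5)))
    (Seq (assign J 22 (Read (Bin Add (Var 10) (Bin Mult (Num 2) (Var 5))) (Var 5)))
    (Seq (assign J 23 (Read (Bin Add (Var 10) (Bin Mult (Num 3) (Var 5))) (Var 5)))
    (Seq (assign J 24 (Bin Add (Bin Add (Var 5) (Var 5)) (Bin Mult (Var 22) (Var 23))))
    (Seq (assign J 25 (Var 2))
    (Seq (rank_com J)
    (Seq (assign J 15 (Var 30))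
    (Seq (assign J 25 (Bin Add (Var 3) (Num 1)))
    (Seq (rank_com J)
    (Seq (assign J 9 (Bin Less (Var 15) (Var 30)))
    (IfNZ 9
      (Seq (assign J 2 (Var 15)) (assign J 3 (Bin Sub (Var 30) (Num 1))))
      (assign J 1 (Num 0)))))))))))))"

text \<open>Top node \<open>a div (br * br)\<close> has an entry for each block
  \<open>a div br\<close> that it covers, and the node of an occurring block has one for each of its
  characters. A lookup yields one plus a rank, which selects among the contiguous second-level nodes
  or headers.\<close>

definition directory_com :: "nat \<Rightarrow> com" where
  "directory_com J =
    Seq (assign J 13 (Bin Add (Var 5) (Bin Mult (Var 6) (Var 6))))
    (Seq (assign J 14 (Bin Divide (Var 0) (Var 6)))
    (Seq (assign J 10 (Bin Add (Bin Add (Var 4) (Bin Mult (Num 5) (Var 5)))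
      (Bin Mult (Bin Divide (Var 14) (Var 6)) (Var 13))))
    (Seq (assign J 11 (Bin Modulo (Var 14) (Var 6)))
    (Seq (lookup_com J)
    (IfNZ 12
      (Seq (assign J 10 (Bin Add (Read (Bin Add (Var 4) (Bin Mult (Num 3) (Var 5))) (Var 5))
        (Bin Mult (Bin Sub (Var 12) (Num 1)) (Var 13))))
      (Seq (assign J 11 (Bin Modulo (Var 0) (Var 6)))
      (Seq (lookup_com J)
      (IfNZ 12
        (Seq (assign J 10 (Bin Add (Read (Bin Add (Var 4) (Bin Mult (Num 4) (Var 5))) (Var 5))
          (Bin Mult (Bin Sub (Var 12) (Num 1)) (Bin Mult (Num 4) (Var 5)))))
          (table_com J))
        (assign J 1 (Num 0))))))
      (assign J 1 (Num 0)))))))"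

text \<open>The program is independent of the text and has no instruction for the word size, so
  \<open>w\<close> is loaded from cell 0. This precedes all other reads, because compiled reads
  expect it in register 4.\<close>

definition query_com :: "nat \<Rightarrow> nat \<Rightarrow> com" where
  "query_com \<kappa> J =
    IfNZ 1
      (Seq (Seq (Const 4 0) (Load 4 4))
      (Seq (assign J 5 (Bin Mult (Num \<kappa>) (Var 4)))
      (Seq (assign J 6 (Read (Var 4) (Var 5)))
      (Seq (assign J 7 (Read (Bin Add (Var 4) (Var 5)) (Var 5)))
      (Seq (assign J 8 (Read (Bin Add (Var 4) (Bin Mult (Num 2) (Var 5))) (Var 5)))
      (Seq (assign J 9 (Bin Equal (Var 0) (Var 8)))
      (IfNZ 9 (terminator_com J) (directory_com J))))))))
      Skip"

lemma (in machine) halts_load_first: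
  assumes "0 < length M" "M ! 0 = v" "0 < N" "Q (U(4 := v))"
  shows "halts N (Seq (Const 4 0) (Load 4 4)) U Q"
proof -
  have "hoare (Seq (Const 4 0) (Load 4 4)) R (\<lambda>R'. \<forall>x<100. R' x = (U(4 := v)) x)"
    if "\<forall>x<100. R x = U x" for R
    using assms(1,2) that by (intro hoare_Seq hoare_Const hoare_Load) simp_all
  moreover have "cost (Seq (Const 4 0) (Load 4 4)) \<le> N * cost (Seq (Const 4 0) (Load 4 4))"
    using assms(3) by simp
  ultimately show ?thesis unfolding halts_def hoare_def using assms(4) by (meson order_trans)
qed

locale rlcsa = bw_text +
  fixes c w :: nat
  assumes word_size: "word_size_ok c w (length T) \<sigma>"
begin

abbreviation "terminator \<equiv> last T"

text \<open>The factor 16 is ample: \<open>length_bits_less\<close> bounds the whole structure by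
  \<open>2 ^ (12 * c * w)\<close> bits.\<close>

definition K :: nat where "K = 16 * c * w"
definition br :: nat where "br = floor_sqrt w"
definition chars :: "nat set" where "chars = set L"
definition blocks :: "nat set" where "blocks = (\<lambda>a. a div br) ` chars"
definition gsize :: "nat \<Rightarrow> nat" where "gsize a = Suc (floor_log (r a))"
text \<open>A gap of at most \<open>2 ^ floor_log (n div r a)\<close> needs one more bit than this
  logarithm, and the slope takes another.\<close>

definition ewidth :: "nat \<Rightarrow> nat" where "ewidth a = floor_log (n div r a) + 2"
text \<open>The extra group makes the entries reach past the last breakpoint, where
  \<open>point\<close> has the value \<open>n\<close>.\<close>

definition ngroups :: "nat \<Rightarrow> nat" where "ngroups a = Suc (card (breakpoints a) div gsize a)"

definition table :: "nat \<Rightarrow> bool list" where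
  "table a = concat (map (group K (gsize a) (ewidth a) (point a) (lf a)) [0..<ngroups a])"

definition node_size :: nat where "node_size = K + br * br"
definition addr1 :: nat where "addr1 = w + 5 * K"
definition addr2 :: nat where "addr2 = addr1 + Suc (\<sigma> div (br * br)) * node_size"
definition addr3 :: nat where "addr3 = addr2 + card blocks * node_size"
definition addr4 :: nat where "addr4 = addr3 + card chars * (4 * K)"

definition preceding :: "nat \<Rightarrow> nat" where
  "preceding a = card {x \<in> chars. x < a}"

definition table_addr :: "nat \<Rightarrow> nat" where
  "table_addr a = addr4 + length (concat (take (preceding a) (map table (sorted_list_of_set chars))))"

definition header :: "nat \<Rightarrow> bool list" where
  "header a = field K (table_addr a) @ field K (ngroups a) @ field K (gsize a) @ field K (ewidth a)"

text \<open>The top nodes follow a prefix of length \<open>addr1\<close>, known to the program, so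
  only \<open>addr2\<close> and \<open>addr3\<close> are stored. Tables vary in length, and their
  addresses are kept in the headers.\<close>

definition bits :: "bool list" where
  "bits = field w w @ field K br @ field K n @ field K terminator @ field K addr2 @ field K addr3 @
    concat (map (node K br blocks) [0..<Suc (\<sigma> div (br * br))]) @
    concat (map (node K br chars) (sorted_list_of_set blocks)) @
    concat (map header (sorted_list_of_set chars)) @
    concat (map table (sorted_list_of_set chars))"

text \<open>\<open>J\<close> is the number of cells that are loaded to read one field, and \<open>wpr\<close> the number of words of
  a register.\<close>

definition J :: nat where "J = 16 * c + 1"
definition wpr :: nat where "wpr = 48 * c + 3"

definition cells :: "nat list" where
  "cells = map (\<lambda>i. read_bits bits (i * w) w) [0..<length bits div w + J]"


lemma w_pos: "0 < w"
  using word_size by (simp add: word_size_ok_def)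

section \<open>Magnitudes: addresses and counts fit in \<open>K\<close> bits\<close>

lemma n_le: "n \<le> 2 ^ (c * w)"
proof -
  have "log 2 (real n) \<le> real (c * w)" using word_size by (simp add: word_size_ok_def)
  hence "real n \<le> 2 powr real (c * w)" using length_ge_2 by (subst (asm) log_le_iff) auto
  also have "\<dots> = real (2 ^ (c * w))"
    using powr_realpow[of 2 "c * w"] by (simp del: of_nat_mult)
  finally show ?thesis by (simp only: of_nat_le_iff)
qed

lemma sigma_le: "\<sigma> \<le> 2 ^ (c * w)"
  using word_size by (simp add: word_size_ok_def)

lemma cw_pos: "0 < c * w"
proof (rule ccontr)
  assume "\<not> 0 < c * w"
  hence "(2::nat) ^ (c * w) = 1" by simp
  with n_le length_ge_2 show False by linarith
qed

lemma c_pos: "0 < c"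
  using cw_pos by simp

lemma K_eq: "K = 16 * (c * w)"
  by (simp add: K_def)

lemma w_le_K: "w \<le> K"
  using mult_le_mono1[of 1 c w] c_pos by (simp add: K_eq)

lemma K_pos: "0 < K"
  using w_le_K w_pos by linarith

lemma br_pos: "0 < br"
  using w_pos by (simp add: br_def)

lemma br_le: "br * br \<le> w" "br \<le> K"
proof -
  show "br * br \<le> w" using floor_sqrt_power2_le[of w] by (simp add: br_def power2_eq_square)
  show "br \<le> K" using floor_sqrt_le[of w] w_le_K by (simp add: br_def)
qed

lemma finite_chars [simp]: "finite chars" and finite_blocks [simp]: "finite blocks"
  by (simp_all add: chars_def blocks_def)

lemma card_chars_le: "card chars \<le> n"
  using card_length[of L] by (simp add: chars_def)

lemma card_blocks_le: "card blocks \<le> card chars"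
  unfolding blocks_def by (rule card_image_le) simp

lemma gsize_pos: "0 < gsize a"
  by (simp add: gsize_def)

lemma length_table: "length (table a) = ngroups a * (K + K + gsize a * ewidth a)"
  unfolding table_def by (subst length_concat_const[of _ _ "K + K + gsize a * ewidth a"]) simp_all

lemma length_header: "length (header a) = 4 * K"
  by (simp add: header_def)

lemma length_bits: "length bits = addr4 + (\<Sum>a\<in>chars. length (table a))"
proof -
  have "length (concat (map table (sorted_list_of_set chars))) =
      (\<Sum>a\<in>chars. length (table a))"
    by (simp add: length_concat sum_list_distinct_conv_sum_set comp_def)
  moreover have "length (concat (map (node K br blocks) [0..<Suc (\<sigma> div (br * br))])) =
      Suc (\<sigma> div (br * br)) * node_size"
    by (subst length_concat_const[of _ _ node_size]) (simp_all add: node_size_def)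
  moreover have "length (concat (map (node K br chars) (sorted_list_of_set blocks))) =
      card blocks * node_size"
    by (subst length_concat_const[of _ _ node_size]) (simp_all add: node_size_def)
  moreover have "length (concat (map header (sorted_list_of_set chars))) = card chars * (4 * K)"
    by (subst length_concat_const[of _ _ "4 * K"]) (simp_all add: length_header)
  ultimately show ?thesis
    unfolding bits_def length_append length_field addr4_def addr3_def addr2_def addr1_def
    by linarith
qed

lemma floor_log_less: "floor_log x < x" if "0 < x" for x :: nat
  using floor_log_exp2_le[OF that] less_exp[of "floor_log x"] by linarith

lemma ewidth_le: "ewidth a \<le> K"
proof -
  have "floor_log (n div r a) \<le> floor_log (2 ^ (c * w))"
    by (rule floor_log_le_iff) (use n_le div_le_dividend[of n "r a"] in linarith)
  hence "ewidth a \<le> c * w + 2" by (simp add: ewidth_def)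
  thus ?thesis using cw_pos unfolding K_eq by linarith
qed

lemma gsize_le: "a \<in> chars \<Longrightarrow> gsize a \<le> n"
  using floor_log_less[OF num_runs_of_pos[of a L]] num_runs_of_le_length[of a L]
  by (simp add: gsize_def chars_def)

lemma ngroups_le: "ngroups a \<le> Suc n"
  unfolding ngroups_def
  using le_trans[OF div_le_dividend card_breakpoints_le_n, of a "gsize a"] by simp

text \<open>The length depends on \<open>K\<close> itself, but only linearly, and \<open>K\<close>
  is logarithmic in \<open>Y\<close>. Everything else is a polynomial in \<open>Y\<close>, as both
  \<open>n\<close> and \<sigma> are at most \<open>Y\<close>.\<close>

lemma length_bits_less: "length bits < 2 ^ K"
proof -
  define Y :: nat where "Y = 2 ^ (c * w)"
  have Y2: "2 \<le> Y" using power_increasing[of 1 "c * w" "2::nat"] cw_pos by (simp add: Y_def)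
  have tab: "length (table a) \<le> (Y + 1) * (2 * K + Y * K)" if "a \<in> chars" for a
    unfolding length_table using ngroups_le[of a] n_le gsize_le[OF that] ewidth_le[of a]
    by (intro mult_mono add_mono) (simp_all add: Y_def)
  have "(\<Sum>a\<in>chars. length (table a)) \<le> card chars * ((Y + 1) * (2 * K + Y * K))"
    using sum_bounded_above[of chars "\<lambda>a. length (table a)"] tab by simp
  also have "\<dots> \<le> Y * ((Y + 1) * (2 * K + Y * K))"
    using card_chars_le n_le by (intro mult_right_mono) (simp_all add: Y_def)
  finally have 1: "(\<Sum>a\<in>chars. length (table a)) \<le> Y * ((Y + 1) * (2 * K + Y * K))" .
  have ns: "node_size \<le> 2 * K" using br_le(1) w_le_K by (simp add: node_size_def)
  have "Suc (\<sigma> div (br * br)) * node_size \<le> (Y + 1) * (2 * K)"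
    using ns le_trans[OF div_le_dividend sigma_le]
    by (intro mult_mono) (simp_all add: Y_def)
  moreover have "card blocks * node_size \<le> Y * (2 * K)"
    using ns card_blocks_le card_chars_le n_le by (intro mult_mono) (simp_all add: Y_def)
  moreover have "card chars * (4 * K) \<le> Y * (4 * K)"
    using card_chars_le n_le by (intro mult_right_mono) (simp_all add: Y_def)
  ultimately have "length bits \<le> K + 5 * K + (Y + 1) * (2 * K) + Y * (2 * K) + Y * (4 * K) +
      Y * ((Y + 1) * (2 * K + Y * K))"
    using 1 w_le_K unfolding length_bits addr4_def addr3_def addr2_def addr1_def by linarith
  also have "\<dots> = K * (8 + 10 * Y + 3 * (Y * Y) + Y * Y * Y)" by (simp add: algebra_simps)
  also have "\<dots> \<le> K * (16 * (Y * Y * Y))"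
  proof (rule mult_le_mono2)
    have "2 * 2 \<le> Y * Y" using Y2 by (intro mult_mono) auto
    hence "4 * Y \<le> Y * Y * Y" by (intro mult_right_mono) simp_all
    moreover have "2 * (Y * Y) \<le> Y * (Y * Y)" using Y2 by (intro mult_right_mono) simp_all
    ultimately show "8 + 10 * Y + 3 * (Y * Y) + Y * Y * Y \<le> 16 * (Y * Y * Y)"
      using Y2 unfolding mult.assoc by linarith
  qed
  also have "\<dots> < (16 * Y) * (16 * (Y * Y * Y))"
    using less_exp[of "c * w"] Y2 by (intro mult_strict_right_mono) (simp_all add: K_def Y_def)
  also have "\<dots> = 256 * Y ^ 4" by (simp add: power4_eq_xxxx)
  \<comment> \<open>\<open>256 = 2 ^ 8\<close> is turned into a power of \<open>Y\<close>, using
    \<open>2 \<le> Y\<close>.\<close>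
  also have "\<dots> \<le> Y ^ 8 * Y ^ 4"
    using power_mono[OF Y2, of 8] by (intro mult_right_mono) simp_all
  also have "\<dots> = 2 ^ (12 * (c * w))" by (simp add: Y_def power_mult[symmetric] power_add[symmetric] mult.commute)
  also have "\<dots> \<le> 2 ^ K" by (intro power_increasing) (simp_all add: K_def)
  finally show ?thesis .
qed

lemma n2_less: "2 * n < 2 ^ K" "\<sigma> < 2 ^ K"
proof -
  have "2 * n \<le> 2 ^ (c * w + 1)" using n_le by simp
  also have "\<dots> < 2 ^ K"
    using cw_pos unfolding K_eq by (intro power_strict_increasing) linarith+
  finally show "2 * n < 2 ^ K" .
  have "(2::nat) ^ (c * w) < 2 ^ K"
    using cw_pos unfolding K_eq by (intro power_strict_increasing) linarith+
  with sigma_le show "\<sigma> < 2 ^ K" by linarith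
qed

text \<open>Leaves three bits above \<open>K\<close>, so that sums of a few \<open>K\<close>-bit
  numbers do not wrap.\<close>

lemma K_less_wpr: "2 ^ K * 8 < (2::nat) ^ (wpr * w)"
proof -
  have "(2::nat) ^ K * 8 = 2 ^ (K + 3)" by (simp add: power_add)
  also have "\<dots> < 2 ^ (wpr * w)"
  proof (rule power_strict_increasing)
    have "wpr * w = 48 * (c * w) + 3 * w" by (simp add: wpr_def add_mult_distrib)
    thus "K + 3 < wpr * w" using w_pos cw_pos unfolding K_eq by linarith
  qed simp
  finally show ?thesis .
qed

lemma length_cells: "length cells = length bits div w + J"
  by (simp add: cells_def)

sublocale machine w wpr J bits cells
proof
  show "length cells < 2 ^ (wpr * w)"
  proof -
    have "16 * c * 1 \<le> 16 * c * w" using w_pos by (intro mult_le_mono2) simp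
    hence "J \<le> K + 1" by (simp add: K_def J_def)
    moreover have "K < 2 ^ K" by (rule less_exp)
    ultimately show ?thesis
      using length_bits_less K_less_wpr div_le_dividend[of "length bits" w]
      unfolding length_cells by linarith
  qed
qed (use w_pos in \<open>simp_all add: cells_def length_cells J_def wpr_def\<close>)

lemma cells_less: "x \<in> set cells \<Longrightarrow> x < 2 ^ w"
  by (auto simp: cells_def read_bits_def intro: bits_val_less)

end

section \<open>Correctness of the query\<close>

context rlcsa
begin

lemma K_width: "K + w \<le> J * w"
  by (simp add: K_def J_def)

lemma terminator_less: "terminator < 2 ^ K"
proof -
  have "terminator \<in> set T" using length_ge_2 by (intro last_in_set) auto
  moreover have "set T \<subseteq> {..<\<sigma>}" using valid by (simp add: valid_text_def)
  ultimately have "terminator < \<sigma>" by blast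
  with n2_less show ?thesis by linarith
qed

lemma less_K: "x \<le> K \<Longrightarrow> x < 2 ^ K"
  by (rule le_less_trans[OF _ less_exp])

lemma le_bits_less: "x \<le> length bits \<Longrightarrow> x < 2 ^ K"
  by (rule le_less_trans[OF _ length_bits_less])

lemma addr_le: "addr1 \<le> addr2" "addr2 \<le> addr3" "addr3 \<le> addr4" "addr4 \<le> length bits"
  by (simp_all add: addr2_def addr3_def addr4_def length_bits)

section \<open>Locating the components of the bit string\<close>

lemma occurs_at_refl: "bs = xs \<Longrightarrow> occurs_at bs 0 xs"
  by (auto simp: occurs_at_def)

lemma bits_layout:
  "read_bits bits 0 w = w" "read_bits bits w K = br" "read_bits bits (w + K) K = n"
  "read_bits bits (w + 2 * K) K = terminator"
  "read_bits bits (w + 3 * K) K = addr2" "read_bits bits (w + 4 * K) K = addr3"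
  "occurs_at bits addr1 (concat (map (node K br blocks) [0..<Suc (\<sigma> div (br * br))]))"
  "occurs_at bits addr2 (concat (map (node K br chars) (sorted_list_of_set blocks)))"
  "occurs_at bits addr3 (concat (map header (sorted_list_of_set chars)))"
  "occurs_at bits addr4 (concat (map table (sorted_list_of_set chars)))"
proof -
  have e: "w + K + K = w + 2 * K" "w + 2 * K + K = w + 3 * K" "w + 3 * K + K = w + 4 * K"
    "w + 4 * K + K = w + 5 * K" by simp_all
  note f0 = occurs_at_append[OF occurs_at_refl[OF bits_def], unfolded length_field add_0]
  note f1 = occurs_at_append[OF conjunct2[OF f0], unfolded length_field]
  note f2 = occurs_at_append[OF conjunct2[OF f1], unfolded length_field e]
  note f3 = occurs_at_append[OF conjunct2[OF f2], unfolded length_field e]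
  note f4 = occurs_at_append[OF conjunct2[OF f3], unfolded length_field e]
  note f5 = occurs_at_append[OF conjunct2[OF f4], unfolded length_field e]
  note o1 = conjunct1[OF f0] conjunct1[OF f1] conjunct1[OF f2] conjunct1[OF f3] conjunct1[OF f4]
  show "read_bits bits 0 w = w" using o1(1) less_exp by (rule read_field)
  show "read_bits bits w K = br" using o1(2) less_K[OF br_le(2)] by (rule read_field)
  have "n < 2 ^ K" using n2_less by linarith
  with o1(3) show "read_bits bits (w + K) K = n" by (rule read_field)
  show "read_bits bits (w + 2 * K) K = terminator" using o1(4) terminator_less by (rule read_field)
  have "addr2 < 2 ^ K" "addr3 < 2 ^ K" using addr_le by (auto intro: le_bits_less)
  thus "read_bits bits (w + 3 * K) K = addr2" "read_bits bits (w + 4 * K) K = addr3"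
    using read_field o1(5) conjunct1[OF f5] by blast+
  have l1: "length (concat (map (node K br blocks) [0..<Suc (\<sigma> div (br * br))])) =
      Suc (\<sigma> div (br * br)) * node_size"
    by (subst length_concat_const[of _ _ node_size]) (simp_all add: node_size_def)
  have l2: "length (concat (map (node K br chars) (sorted_list_of_set blocks))) =
      card blocks * node_size"
    by (subst length_concat_const[of _ _ node_size]) (simp_all add: node_size_def)
  have l3: "length (concat (map header (sorted_list_of_set chars))) = card chars * (4 * K)"
    by (subst length_concat_const[of _ _ "4 * K"]) (simp_all add: length_header)
  note o2 = occurs_at_append[OF conjunct2[OF f5], folded addr1_def, unfolded l1, folded addr2_def]
  note o3 = occurs_at_append[OF conjunct2[OF o2], unfolded l2, folded addr3_def]
  note o4 = occurs_at_append[OF conjunct2[OF o3], unfolded l3, folded addr4_def]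
  show "occurs_at bits addr1 (concat (map (node K br blocks) [0..<Suc (\<sigma> div (br * br))]))"
    "occurs_at bits addr2 (concat (map (node K br chars) (sorted_list_of_set blocks)))"
    "occurs_at bits addr3 (concat (map header (sorted_list_of_set chars)))"
    "occurs_at bits addr4 (concat (map table (sorted_list_of_set chars)))"
    using o2 o3 o4 by blast+
qed

lemma top_node:
  "q \<le> \<sigma> div (br * br) \<Longrightarrow> occurs_at bits (addr1 + q * node_size) (node K br blocks q)"
  by (rule occurs_at_concat_upt[OF bits_layout(7)]) (simp_all add: node_size_def)

lemma bottom_node:
  assumes "x \<in> blocks"
  shows "occurs_at bits (addr2 + card {y \<in> blocks. y < x} * node_size) (node K br chars x)"
  using occurs_at_concat_const[OF bits_layout(8), of node_size "card {y \<in> blocks. y < x}"]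
    nth_sorted_list_of_set_card_less[OF finite_blocks assms]
  by (simp add: node_size_def)

lemma preceding_less: "a \<in> chars \<Longrightarrow> preceding a < card chars"
  and nth_preceding: "a \<in> chars \<Longrightarrow> sorted_list_of_set chars ! preceding a = a"
  unfolding preceding_def using nth_sorted_list_of_set_card_less[OF finite_chars] by blast+

lemma header_at:
  assumes "a \<in> chars"
  shows "occurs_at bits (addr3 + preceding a * (4 * K)) (header a)"
  using occurs_at_concat_const[OF bits_layout(9), of "4 * K" "preceding a"]
    preceding_less[OF assms] nth_preceding[OF assms]
  by (simp add: length_header)

lemma table_at:
  assumes "a \<in> chars"
  shows "occurs_at bits (table_addr a) (table a)"
  using occurs_at_concat[OF bits_layout(10), of "preceding a"]
    preceding_less[OF assms] nth_preceding[OF assms]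
  by (simp add: table_addr_def)

lemma lf_less_K: "i \<le> n \<Longrightarrow> lf a i < 2 ^ K"
  using lf_le[of i a] n2_less(1) by linarith

text \<open>The number of groups and the length of their entries are bounded through the length of
  the table, which is itself a part of \<open>bits\<close>.\<close>

lemma header_fields:
  assumes a: "a \<in> chars" and p: "p = addr3 + preceding a * (4 * K)"
  shows "read_bits bits p K = table_addr a" "read_bits bits (p + K) K = ngroups a"
    "read_bits bits (p + 2 * K) K = gsize a" "read_bits bits (p + 3 * K) K = ewidth a"
    "p + 4 * K \<le> length bits" "gsize a * ewidth a < 2 ^ K"
proof -
  note o1 = occurs_at_append[OF header_at[OF a, folded p, unfolded header_def], unfolded length_field]
  note o2 = occurs_at_append[OF conjunct2[OF o1], unfolded length_field]
  note o3 = occurs_at_append[OF conjunct2[OF o2], unfolded length_field]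
  have K23: "p + K + K = p + 2 * K" "p + 2 * K + K = p + 3 * K" by simp_all
  note o3' = o3[unfolded K23]
  note le = occurs_at_le[OF table_at[OF a], unfolded length_table]
  have "ngroups a * 1 \<le> ngroups a * (K + K + gsize a * ewidth a)"
    by (intro mult_le_mono2) (use K_pos in simp)
  hence ng: "ngroups a < 2 ^ K" using le by (intro le_bits_less) linarith
  have "gsize a * ewidth a \<le> ngroups a * (K + K + gsize a * ewidth a)"
    by (simp add: ngroups_def)
  thus "gsize a * ewidth a < 2 ^ K" using le by (intro le_bits_less) simp
  have ta: "table_addr a < 2 ^ K" using le by (intro le_bits_less) simp
  have gs: "gsize a < 2 ^ K" using gsize_le[OF a] n2_less by simp
  show "read_bits bits p K = table_addr a" using conjunct1[OF o1] ta by (rule read_field)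
  show "read_bits bits (p + K) K = ngroups a" using conjunct1[OF o2] ng by (rule read_field)
  show "read_bits bits (p + 2 * K) K = gsize a" using conjunct1[OF o3'] gs by (rule read_field)
  show "read_bits bits (p + 3 * K) K = ewidth a"
    using conjunct2[OF o3'] less_K[OF ewidth_le] by (rule read_field)
  show "p + 4 * K \<le> length bits" using occurs_at_le[OF header_at[OF a]] by (simp add: p length_header)
qed

text \<open>At most \<open>4 * r a\<close> breakpoints are fewer than
  \<open>8 * 2 ^ floor_log (r a)\<close>, and the extra group is absorbed by the next power of two.
  The exponent bounds the halvings of the binary search.\<close>

lemma ngroups_le_power: "a \<in> chars \<Longrightarrow> ngroups a \<le> 2 ^ (floor_log (r a) + 4)"
proof -
  assume a: "a \<in> chars"
  have "card (breakpoints a) div gsize a \<le> card (breakpoints a)" by (rule div_le_dividend)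
  moreover have "r a < 2 * 2 ^ floor_log (r a)" by (rule floor_log_exp2_gt)
  moreover have "card (breakpoints a) \<le> 4 * r a" using card_breakpoints a by (simp add: chars_def)
  moreover have "(2::nat) ^ (floor_log (r a) + 4) = 16 * 2 ^ floor_log (r a)"
    by (simp add: power_add)
  moreover have "(1::nat) \<le> 2 ^ floor_log (r a)" by simp
  ultimately show ?thesis unfolding ngroups_def by linarith
qed

lemma breakpoints_covered: "point a (ngroups a * gsize a) = n"
proof (rule point_end)
  show "card (breakpoints a) \<le> ngroups a * gsize a"
    using dividend_less_div_times[OF gsize_pos, of "card (breakpoints a)" a]
    by (simp add: ngroups_def)
qed

lemma gap_width: "2 * (point a (Suc t) - point a t) + 1 < 2 ^ ewidth a"
proof -
  have "(1::nat) \<le> 2 ^ floor_log (n div r a)" by simp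
  moreover have "point a (Suc t) - point a t \<le> 2 ^ floor_log (n div r a)"
    using point_gap[of a t] by (simp add: stride_def)
  moreover have "(2::nat) ^ ewidth a = 4 * 2 ^ floor_log (n div r a)" by (simp add: ewidth_def)
  ultimately show ?thesis by linarith
qed

section \<open>Verification of the query program\<close>

lemma halts_rank_lf:
  assumes a: "a \<in> chars" and i: "i \<le> n" and N: "floor_log (r a) + 4 < N"
    and U: "U 4 = w" "U 5 = K" "U 20 = table_addr a" "U 21 = ngroups a" "U 22 = gsize a"
      "U 23 = ewidth a" "U 24 = K + K + gsize a * ewidth a" "U 25 = i"
    and Q: "\<And>U'. U' 30 = lf a i \<Longrightarrow> (\<forall>x. x \<notin> {26..32} \<longrightarrow> U' x = U x) \<Longrightarrow> Q U'"
  shows "halts N (rank_com J) U Q"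
proof (rule halts_rank[where p = "point a" and F = "lf a" and h = "floor_log (r a) + 4"])
  show "occurs_at bits (table_addr a)
      (concat (map (group K (gsize a) (ewidth a) (point a) (lf a)) [0..<ngroups a]))"
    using table_at[OF a] by (simp add: table_def)
  show "point a t \<le> point a (Suc t)" for t by (rule point_Suc_ge)
  show "point a 0 \<le> i" by (simp add: point_0)
  show "i \<le> point a (ngroups a * gsize a)" using i by (simp add: breakpoints_covered)
  show "point a t < 2 ^ K" for t using point_le_n[of a t] n2_less(1) by linarith
  show "0 < ngroups a" by (simp add: ngroups_def)
  show "ngroups a \<le> 2 ^ (floor_log (r a) + 4)" using a by (rule ngroups_le_power)
  show "lf a x < 2 ^ K" if "x \<le> i" for x using that i by (intro lf_less_K) simp
  show "i < 2 ^ K" using i n2_less(1) by linarith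
  show "gsize a < 2 ^ K" using gsize_le[OF a] n2_less(1) by linarith
  show "2 ^ K < (2::nat) ^ (wpr * w)" using K_less_wpr by linarith
  show "floor_log (r a) + 4 < N" "gsize a < N" using N by (simp_all add: gsize_def)
qed (use U Q K_width gap_width ewidth_le K_pos lf_slope lf_linear length_bits_less in auto)

lemma register_bounds: "length bits < B" "5 * K < B" "K < B" "2 * 2 ^ K + 2 * K < B" "7 < B" "2 * n < B"
proof -
  have K: "K < 2 ^ K" by (rule less_exp)
  show "length bits < B" "5 * K < B" "K < B" "2 * 2 ^ K + 2 * K < B" "2 * n < B"
    using length_bits_less K_less_wpr K n2_less by linarith+
  have "(1::nat) \<le> 2 ^ K" by simp
  with K_less_wpr show "7 < B" by linarith
qed

lemma halts_table:
  assumes a: "a \<in> chars" and se: "s \<le> e" "e < n" and N: "floor_log (r a) + 4 < N"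
    and U: "U 4 = w" "U 5 = K" "U 10 = addr3 + preceding a * (4 * K)"
      "U 1 = 1" "U 2 = s" "U 3 = e"
  shows "halts N (table_com J) U (\<lambda>U'. query_output U' =
    (if lf a s < lf a (Suc e) then Some (lf a s, lf a (Suc e) - 1) else None))"
proof -
  define p where "p = addr3 + preceding a * (4 * K)"
  note h = header_fields[OF a p_def]
  have U10: "U 10 = p" using U(3) by (simp add: p_def)
  have N0: "0 < N" using N by simp
  have sB: "7 < B" "length bits < B" "5 * K < B" "K < B" "2 * K < B" "3 * K < B"
    "K + K + gsize a * ewidth a < B" "gsize a * ewidth a < B" "K + K < B" "Suc e < B"
    using register_bounds h(6) se by linarith+
  have p_le: "p \<le> length bits" "p + K \<le> length bits" "p + 2 * K \<le> length bits"
    "p + 3 * K \<le> length bits" using h(5) by linarith+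
  have pB: "p + K < B" "p + 2 * K < B" "p + 3 * K < B" using p_le sB by linarith+
  have lfB: "lf a (Suc e) < B" using lf_less_K[of "Suc e" a] se K_less_wpr by simp
  show ?thesis
    unfolding table_com_def
    apply (rule halts_step[where v = "table_addr a"])
          apply (use U U10 N0 sB p_le pB h(1-4) K_width in simp_all)[6]
    apply (rule halts_step[where v = "ngroups a"])
          apply (use U U10 N0 sB p_le pB h(1-4) K_width in simp_all)[6]
    apply (rule halts_step[where v = "gsize a"])
          apply (use U U10 N0 sB p_le pB h(1-4) K_width in simp_all)[6]
    apply (rule halts_step[where v = "ewidth a"])
          apply (use U U10 N0 sB p_le pB h(1-4) K_width in simp_all)[6]
    apply (rule halts_step[where v = "K + K + gsize a * ewidth a"])
          apply (use U N0 sB in simp_all)[6]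
    apply (rule halts_step[where v = s])
          apply (use U N0 in simp_all)[6]
    apply (rule halts_Seq)
    apply (rule halts_rank_lf[OF a, where i = s])
              apply (use U se N in simp_all)[10]
  proof -
    fix V
    assume V: "V 30 = lf a s" and "\<forall>x. x \<notin> {26..32} \<longrightarrow> V x =
      (U(20 := table_addr a, 21 := ngroups a, 22 := gsize a, 23 := ewidth a,
         24 := K + K + gsize a * ewidth a, 25 := s)) x"
    hence V': "V 1 = 1" "V 3 = e" "V 4 = w" "V 5 = K" "V 20 = table_addr a" "V 21 = ngroups a"
      "V 22 = gsize a" "V 23 = ewidth a" "V 24 = K + K + gsize a * ewidth a"
      using U by simp_all
    show "halts N (Seq (assign J 15 (Var 30))
      (Seq (assign J 25 (Bin Add (Var 3) (Num 1)))
      (Seq (rank_com J)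
      (Seq (assign J 9 (Bin Less (Var 15) (Var 30)))
      (IfNZ 9
        (Seq (assign J 2 (Var 15)) (assign J 3 (Bin Sub (Var 30) (Num 1))))
        (assign J 1 (Num 0))))))) V (\<lambda>U'. query_output U' =
      (if lf a s < lf a (Suc e) then Some (lf a s, lf a (Suc e) - 1) else None))"
      apply (rule halts_step[where v = "lf a s"])
            apply (use V V' N0 in simp_all)[6]
      apply (rule halts_step[where v = "Suc e"])
            apply (use V V' N0 sB in simp_all)[6]
      apply (rule halts_Seq)
      apply (rule halts_rank_lf[OF a, where i = "Suc e"])
                apply (use V' se N in simp_all)[10]
    proof -
      fix W
      assume W: "W 30 = lf a (Suc e)" and "\<forall>x. x \<notin> {26..32} \<longrightarrow> W x =
        (V(15 := lf a s, 25 := Suc e)) x"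
      hence W': "W 1 = 1" "W 4 = w" "W 15 = lf a s" using V' by simp_all
      show "halts N (Seq (assign J 9 (Bin Less (Var 15) (Var 30)))
        (IfNZ 9
          (Seq (assign J 2 (Var 15)) (assign J 3 (Bin Sub (Var 30) (Num 1))))
          (assign J 1 (Num 0)))) W (\<lambda>U'. query_output U' =
        (if lf a s < lf a (Suc e) then Some (lf a s, lf a (Suc e) - 1) else None))"
        apply (rule halts_step[where v = "if lf a s < lf a (Suc e) then 1 else 0"])
              apply (use W W' N0 in simp_all)[6]
        apply (rule halts_IfNZ)
           apply (use N0 in simp_all)[2]
         apply (rule halts_step[where v = "lf a s"])
               apply (use W W' N0 in simp_all)[6]
         apply (rule halts_assign)
              apply (use W W' N0 lfB sB in \<open>simp_all split: if_splits\<close>)[5]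
         apply (use W W' in \<open>simp add: query_output_def split: if_splits\<close>)
        apply (rule halts_assign)
             apply (use W W' N0 in simp_all)[5]
        apply (use W W' in \<open>simp add: query_output_def split: if_splits\<close>)
        done
    qed
  qed
qed

lemma halts_directory:
  assumes a: "a < \<sigma>" "a \<noteq> terminator" and I: "sa_interval T P = Some (s, e)"
    and N: "floor_log (r a) + 4 < N"
    and U: "U 0 = a" "U 1 = 1" "U 2 = s" "U 3 = e" "U 4 = w" "U 5 = K" "U 6 = br"
  shows "halts N (directory_com J) U (\<lambda>U'. query_output U' = sa_interval T (a # P))"
proof -
  have N0: "0 < N" using N by simp
  define q where "q = a div br"
  have q: "(q div br) * br + q mod br = q" "q * br + a mod br = a" "q mod br < br" "a mod br < br"
    using br_pos by (simp_all add: q_def)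
  have se: "s \<le> e" "e < n" using sa_interval_bounds[OF I] .
  \<comment> \<open>\<open>q div br\<close> equals \<open>a div (br * br)\<close>, so the top node
    of \<open>a\<close> is among the stored ones.\<close>
  have "q div br \<le> \<sigma> div (br * br)"
    using a by (simp add: q_def div_mult2_eq[symmetric] div_le_mono)
  note top = top_node[OF this]
  define p where "p = addr1 + (q div br) * node_size"
  have p_le: "p + node_size \<le> length bits" using occurs_at_le[OF top] by (simp add: p_def node_size_def)
  have ns: "K \<le> node_size" "br * br \<le> node_size" by (simp_all add: node_size_def)
  have pB: "p < B" "(q div br) * node_size < B" "node_size < B" "br * br < B" "w + 5 * K < B"
    using p_le ns register_bounds by (simp_all add: p_def addr1_def)
  have cX: "card blocks < 2 ^ K" "card chars < 2 ^ K"
    using card_blocks_le card_chars_le n2_less by linarith+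
  have K_B: "2 ^ K < B" using register_bounds by linarith
  define res where "res = (if q \<in> blocks then Suc (card {x \<in> blocks. x < q}) else 0)"
  define res2 where "res2 = (if a \<in> chars then Suc (preceding a) else 0)"
  have no: "query_output U' = sa_interval T (a # P)" if "a \<notin> chars" "U' 1 = 0" for U'
    using sa_interval_Cons_absent[OF I a(2)] that by (simp add: query_output_def chars_def)
  show ?thesis
    unfolding directory_com_def
    apply (rule halts_step[where v = node_size])
          apply (use U N0 pB in \<open>simp_all add: node_size_def\<close>)[6]
    apply (rule halts_step[where v = q])
          apply (use U N0 in \<open>simp_all add: q_def\<close>)[6]
    apply (rule halts_step[where v = p])
          apply (use U N0 pB register_bounds in \<open>simp_all add: p_def addr1_def\<close>)[6]
    apply (rule halts_step[where v = "q mod br"])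
          apply (use U N0 in simp_all)[6]
    apply (rule halts_Seq)
    apply (rule halts_lookup[OF _ _ _ _ _ top[folded p_def], where j = "q mod br"])
                 apply (use U q cX K_width br_le register_bounds K_B N0 in simp_all)[13]
    \<comment> \<open>The lookup result mentions quotient and remainder of \<open>q\<close> twice;
      both occurrences are recombined to \<open>q\<close>.\<close>
    apply (subst q(1), subst q(1), subst res_def[symmetric])
    apply (rule halts_IfNZ)
       apply (use N0 in simp_all)[2]
  proof -
    let ?U = "U(13 := node_size, 14 := q, 10 := p, 11 := q mod br, 12 := res)"
    assume "?U 12 = 0"
    hence "q \<notin> blocks" by (simp add: res_def split: if_splits)
    hence "a \<notin> chars" by (auto simp: blocks_def q_def)
    thus "halts N (assign J 1 (Num 0)) ?U (\<lambda>U'. query_output U' = sa_interval T (a # P))"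
      using U N0 by (intro halts_assign no) simp_all
  next
    let ?U = "U(13 := node_size, 14 := q, 10 := p, 11 := q mod br, 12 := res)"
    assume "?U 12 \<noteq> 0"
    hence qb: "q \<in> blocks" by (simp add: res_def split: if_splits)
    define p2 where "p2 = addr2 + card {x \<in> blocks. x < q} * node_size"
    note bot = bottom_node[OF qb, folded p2_def]
    have p2_le: "p2 + node_size \<le> length bits" using occurs_at_le[OF bot] by (simp add: node_size_def)
    have p2B: "p2 < B" "card {x \<in> blocks. x < q} * node_size < B" "addr2 < B"
      using p2_le register_bounds by (simp_all add: p2_def)
    have res: "res = Suc (card {x \<in> blocks. x < q})" using qb by (simp add: res_def)
    have le: "w + 3 * K \<le> length bits" "w + 4 * K \<le> length bits" "w + 3 * K < B" "w + 4 * K < B"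
      "addr2 \<le> length bits" "addr3 \<le> length bits"
      using addr_le register_bounds unfolding addr1_def[symmetric] by (simp_all add: addr1_def)
    have "card {x \<in> blocks. x < q} \<le> card blocks" by (intro card_mono) auto
    hence resB: "res < B" using res cX K_B by linarith
    show "halts N (Seq (assign J 10 (Bin Add (Read (Bin Add (Var 4) (Bin Mult (Num 3) (Var 5))) (Var 5))
          (Bin Mult (Bin Sub (Var 12) (Num 1)) (Var 13))))
        (Seq (assign J 11 (Bin Modulo (Var 0) (Var 6)))
        (Seq (lookup_com J)
        (IfNZ 12
          (Seq (assign J 10 (Bin Add (Read (Bin Add (Var 4) (Bin Mult (Num 4) (Var 5))) (Var 5))
            (Bin Mult (Bin Sub (Var 12) (Num 1)) (Bin Mult (Num 4) (Var 5)))))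
            (table_com J))
          (assign J 1 (Num 0)))))) ?U (\<lambda>U'. query_output U' = sa_interval T (a # P))"
      apply (rule halts_step[where v = p2])
            apply (use U N0 p2B le register_bounds res resB K_width bits_layout(5) in \<open>simp_all add: p2_def\<close>)[6]
      apply (rule halts_step[where v = "a mod br"])
            apply (use U N0 in simp_all)[6]
      apply (rule halts_Seq)
      apply (rule halts_lookup[OF _ _ _ _ _ bot, where j = "a mod br"])
                   apply (use U q cX K_width br_le register_bounds K_B N0 in simp_all)[13]
      apply (subst q(2), subst q(2), subst preceding_def[symmetric], subst res2_def[symmetric])
      apply (rule halts_IfNZ)
         apply (use N0 in simp_all)[2]
    proof -
      let ?V = "?U(10 := p2, 11 := a mod br, 12 := res2)"
      assume "?V 12 = 0"
      hence "a \<notin> chars" by (simp add: res2_def split: if_splits)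
      thus "halts N (assign J 1 (Num 0)) ?V (\<lambda>U'. query_output U' = sa_interval T (a # P))"
        using U N0 by (intro halts_assign no) simp_all
    next
      let ?V = "?U(10 := p2, 11 := a mod br, 12 := res2)"
      assume "?V 12 \<noteq> 0"
      hence ac: "a \<in> chars" by (simp add: res2_def split: if_splits)
      hence res2: "res2 = Suc (preceding a)" by (simp add: res2_def)
      define p3 where "p3 = addr3 + preceding a * (4 * K)"
      have p3: "p3 + 4 * K \<le> length bits" using header_fields(5)[OF ac p3_def] .
      hence p3B: "p3 < B" "preceding a * (4 * K) < B" "addr3 < B" using register_bounds by (simp_all add: p3_def)
      have res2B: "res2 < B" using res2 preceding_less[OF ac] cX K_B by linarith
      show "halts N (Seq (assign J 10 (Bin Add (Read (Bin Add (Var 4) (Bin Mult (Num 4) (Var 5))) (Var 5))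
            (Bin Mult (Bin Sub (Var 12) (Num 1)) (Bin Mult (Num 4) (Var 5)))))
            (table_com J)) ?V (\<lambda>U'. query_output U' = sa_interval T (a # P))"
        apply (rule halts_step[where v = p3])
              apply (use U N0 p3B le register_bounds res2 res2B K_width bits_layout(6) in \<open>simp_all add: p3_def\<close>)[6]
        apply (subst sa_interval_Cons[OF I a(2)])
        apply (rule halts_table[OF ac se N])
             apply (use U in \<open>simp_all add: p3_def\<close>)
        done
    qed
  qed
qed

text \<open>On the full interval register 2 already holds the left endpoint 0, so resetting register
  3 yields the answer \<open>(0, 0)\<close>.\<close>

lemma halts_terminator:
  assumes I: "sa_interval T P = Some (s, e)" and N: "0 < N"
    and U: "U 1 = 1" "U 2 = s" "U 3 = e" "U 4 = w" "U 7 = n"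
  shows "halts N (terminator_com J) U (\<lambda>U'. query_output U' = sa_interval T (terminator # P))"
proof -
  have e: "Suc e < B" "1 < B" using sa_interval_bounds[OF I] register_bounds by linarith+
  show ?thesis
    unfolding terminator_com_def sa_interval_terminator sa_interval_full_iff[OF I, symmetric]
    apply (rule halts_step[where v = "if s = 0 \<and> Suc e = n then 1 else 0"])
          apply (use U N e in \<open>auto split: if_splits\<close>)[6]
    apply (rule halts_IfNZ)
       apply (use N in simp_all)[2]
     apply (rule halts_assign)
          apply (use U N e in \<open>simp_all split: if_splits\<close>)[5]
     apply (use U in \<open>simp add: query_output_def split: if_splits\<close>)
    apply (rule halts_assign)
         apply (use U N e in \<open>simp_all split: if_splits\<close>)[5]
    apply (use U in \<open>auto simp: query_output_def split: if_splits\<close>)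
    done
qed

lemma halts_query:
  assumes a: "a < \<sigma>" and N: "floor_log (r a) + 4 < N"
  shows "halts N (query_com (16 * c) J) (query_input a (sa_interval T P))
    (\<lambda>U'. query_output U' = sa_interval T (a # P))"
proof (cases "sa_interval T P")
  case None
  show ?thesis
    unfolding query_com_def None
    apply (rule halts_IfNZ)
       apply (use N in simp_all)[2]
     apply (simp add: query_input_def)
    apply (rule halts_Skip)
     apply (use N in simp)
    apply (simp add: query_input_def query_output_def sa_interval_Cons_None[OF None])
    done
next
  case (Some I)
  then obtain s e where I: "sa_interval T P = Some (s, e)" by (cases I) auto
  have N0: "0 < N" using N by simp
  have len: "0 < length cells" by (simp add: length_cells J_def)
  have cells: "cells ! 0 = w" using bits_layout(1) nth_M[OF len] by simp
  have le: "w \<le> length bits" "w + K \<le> length bits" "w + 2 * K \<le> length bits" "w + 5 * K \<le> length bits"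
    using addr_le by (simp_all add: addr1_def)
  have sB: "w + K < B" "w + 2 * K < B" "2 * K < B" "K < B" "7 < B" "16 * c < B" "16 * c * w < B"
  proof -
    show "16 * c * w < B" using register_bounds by (simp add: K_def)
    have "16 * c * 1 \<le> 16 * c * w" using w_pos by (intro mult_le_mono2) simp
    with \<open>16 * c * w < B\<close> show "16 * c < B" by linarith
  qed (use le register_bounds in linarith)+
  let ?U = "query_input a (Some (s, e))"
  have U: "?U 0 = a" "?U 1 = 1" "?U 2 = s" "?U 3 = e" by (simp_all add: query_input_def)
  show ?thesis
    unfolding query_com_def I
    apply (rule halts_IfNZ)
       apply (use N in simp_all)[2]
     apply (rule halts_Seq)
     apply (rule halts_load_first[OF len cells N0])
     apply (rule halts_step[where v = K])
           apply (use N0 sB in \<open>simp_all add: K_def\<close>)[6]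
     apply (rule halts_step[where v = br])
           apply (use N0 sB le K_width bits_layout(2) in simp_all)[6]
     apply (rule halts_step[where v = n])
           apply (use N0 sB le K_width bits_layout(3) in simp_all)[6]
     apply (rule halts_step[where v = "terminator"])
           apply (use N0 sB le K_width bits_layout(4) in simp_all)[6]
     apply (rule halts_step[where v = "if a = terminator then 1 else 0"])
           apply (use N0 U in simp_all)[6]
     apply (rule halts_IfNZ)
        apply (use N0 in simp_all)[2]
      apply (simp split: if_splits)
      apply (rule halts_terminator[OF I N0])
          apply (use U in simp_all)[5]
     apply (rule halts_directory[OF a _ I N])
            apply (use U in \<open>simp_all split: if_splits\<close>)[8]
    apply (use U in simp)
    done
qed

end

section \<open>Space and time\<close>

text \<open>The right-hand side is the tangent at \<open>y\<close> of the concave function that maps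
  \<open>x\<close> to \<open>x * log 2 (z / x)\<close>.\<close>

lemma log_tangent:
  fixes x y z :: real
  assumes "0 < x" "0 < y" "0 < z"
  shows "x * log 2 (z / x) \<le> x * log 2 (z / y) + (y - x) / ln 2"
proof -
  have "ln (y / x) \<le> y / x - 1" using assms by (intro ln_le_minus_one) simp
  hence "x * ln (y / x) \<le> x * (y / x - 1)" using assms by (intro mult_left_mono) auto
  also have "\<dots> = y - x" using assms by (simp add: field_simps)
  finally have "x * ln (y / x) / ln 2 \<le> (y - x) / ln 2" by (intro divide_right_mono) auto
  moreover have "log 2 (z / x) = log 2 (z / y) + ln (y / x) / ln 2"
    using assms by (simp add: log_def ln_div diff_divide_distrib)
  ultimately show ?thesis by (simp add: distrib_left)
qed

lemma floor_log_le_log: "0 < x \<Longrightarrow> real (floor_log x) \<le> log 2 (real x)"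
  by (simp add: floor_log_altdef)

lemma log_less_floor_log: "0 < x \<Longrightarrow> log 2 (real x) \<le> real (Suc (floor_log x))"
  by (simp add: floor_log_altdef) linarith

context rlcsa
begin

section \<open>Space of a single character\<close>

lemma n_pos: "0 < real n"
  using length_ge_2 by linarith

lemma log_n_nonneg: "0 \<le> log 2 n"
  using length_ge_2 by (subst zero_le_log_cancel_iff) auto

text \<open>The space budget of a character. The summand 1 keeps it positive when
  \<open>r a = n\<close> and pays for the constant part of each entry.\<close>

definition entropy :: "nat \<Rightarrow> real" where
  "entropy a = r a * (log 2 (n / r a) + 1)"

lemma r_bounds:
  assumes "a \<in> chars"
  shows "0 < r a" "r a \<le> n" "0 \<le> log 2 (n / r a)"
proof -
  show *: "0 < r a" "r a \<le> n"
    using assms num_runs_of_pos num_runs_of_le_length[of a L] by (simp_all add: chars_def)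
  thus "0 \<le> log 2 (n / r a)" using n_pos by (subst zero_le_log_cancel_iff) (auto simp: le_divide_eq)
qed

lemma log_n_eq: "a \<in> chars \<Longrightarrow> log 2 n = log 2 (n / r a) + log 2 (r a)"
  using r_bounds[of a] n_pos by (subst log_divide_pos) auto

lemma log_n_le_gsize: "a \<in> chars \<Longrightarrow> log 2 n \<le> gsize a * (log 2 (n / r a) + 1)"
proof -
  assume a: "a \<in> chars"
  have "1 * log 2 (n / r a) \<le> gsize a * log 2 (n / r a)"
    using r_bounds[OF a] gsize_pos[of a] by (intro mult_right_mono) auto
  moreover have "log 2 (r a) \<le> gsize a"
    using log_less_floor_log[of "r a"] r_bounds[OF a] by (simp add: gsize_def)
  ultimately show ?thesis using log_n_eq[OF a] by (simp add: distrib_left)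
qed

lemma gsize_le_r: "a \<in> chars \<Longrightarrow> gsize a \<le> r a"
  using floor_log_less[of "r a"] r_bounds[of a] by (simp add: gsize_def)

text \<open>A whole group can pay \<open>log 2 n\<close>, and \<open>r a\<close> is at least the
  size of a group. So every occurring character can pay for \<open>O(1)\<close> fields of
  \<open>K\<close> bits.\<close>

lemma log_n_le_entropy:
  assumes "a \<in> chars"
  shows "log 2 n \<le> entropy a"
proof -
  have "gsize a * (log 2 (n / r a) + 1) \<le> entropy a"
    unfolding entropy_def using gsize_le_r[OF assms] r_bounds[OF assms] by (intro mult_right_mono) auto
  with log_n_le_gsize[OF assms] show ?thesis by linarith
qed

lemma w_le_log: "real w \<le> c * log 2 n"
  using word_size by (simp add: word_size_ok_def)

text \<open>Here the upper bound on the word size enters: fields measured in words must be paid for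
  in units of \<open>log 2 n\<close>. One factor \<open>c\<close> comes from \<open>K\<close>, the
  other from \<open>w\<close>.\<close>

lemma K_le_log: "real K \<le> 16 * c^2 * log 2 n"
proof -
  have "real (16 * c) * real w \<le> real (16 * c) * (c * log 2 n)"
    using w_le_log by (intro mult_left_mono) auto
  thus ?thesis by (simp add: K_def power2_eq_square mult_ac)
qed

lemma length_table_le:
  assumes a: "a \<in> chars"
  shows "real (length (table a)) \<le> 170 * c^2 * entropy a"
proof -
  let ?g = "real (gsize a)" and ?m = "real (card (breakpoints a))" and ?l = "log 2 (n / r a)"
  have g: "1 \<le> ?g" using gsize_pos[of a] by linarith
  have c1: "1 \<le> (real c)^2" using c_pos by (simp add: one_le_power)
  have m: "?m \<le> 4 * r a" using card_breakpoints[of a] a by (simp add: chars_def)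
  have l: "0 \<le> ?l" and r: "0 < r a" using r_bounds[OF a] by auto
  have ent0: "0 \<le> entropy a" using l by (simp add: entropy_def)
  have "real (card (breakpoints a) div gsize a) \<le> ?m / ?g" by (rule of_nat_div_le_of_nat)
  hence ng: "real (ngroups a) \<le> 1 + ?m / ?g" by (simp add: ngroups_def)
  have "real K / ?g \<le> 16 * c^2 * (?l + 1)"
  proof -
    have "real K \<le> 16 * c^2 * (?g * (?l + 1))"
      using K_le_log mult_left_mono[OF log_n_le_gsize[OF a], of "16 * c^2"] by simp
    thus ?thesis using g by (simp add: divide_le_eq mult_ac)
  qed
  hence "real (r a) * (real K / ?g) \<le> r a * (16 * c^2 * (?l + 1))" by (intro mult_left_mono) auto
  hence rK: "real (r a) * (real K / ?g) \<le> 16 * c^2 * entropy a" by (simp add: entropy_def mult_ac)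
  have K: "real K \<le> 16 * c^2 * entropy a"
    using K_le_log mult_left_mono[OF log_n_le_entropy[OF a], of "16 * c^2"] by simp
  have "real (ngroups a) * K \<le> (1 + ?m / ?g) * K" using ng by (intro mult_right_mono) auto
  also have "\<dots> = K + ?m * (K / ?g)" by (simp add: distrib_right)
  also have "\<dots> \<le> K + (4 * r a) * (K / ?g)" using m by (intro add_left_mono mult_right_mono) auto
  \<comment> \<open>16 for the extra group and \<open>4 * 16\<close> for those filled by the
    \<open>4 * r a\<close> breakpoints. A group has two such fields, and its entries add 10, which
    gives the final 170.\<close>
  also have "\<dots> \<le> 80 * c^2 * entropy a" using K rK by simp
  finally have 1: "real (ngroups a) * K \<le> 80 * c^2 * entropy a" .
  have "real (ngroups a) * ?g \<le> (1 + ?m / ?g) * ?g" using ng by (intro mult_right_mono) auto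
  also have "\<dots> = ?g + ?m" using g by (simp add: distrib_right)
  also have "\<dots> \<le> 5 * r a" using m gsize_le_r[OF a] by simp
  finally have gg: "real (ngroups a) * ?g \<le> 5 * r a" .
  have "0 < n div r a" using r_bounds[OF a] by (simp add: div_greater_zero_iff)
  hence "real (floor_log (n div r a)) \<le> log 2 (real (n div r a))" by (rule floor_log_le_log)
  also have "\<dots> \<le> ?l"
    using \<open>0 < n div r a\<close> of_nat_div_le_of_nat[of n "r a"] r length_ge_2 by (subst log_le_cancel_iff) auto
  finally have "real (ewidth a) \<le> 2 * (?l + 1)" using l by (simp add: ewidth_def)
  hence "(real (ngroups a) * ?g) * ewidth a \<le> (5 * r a) * (2 * (?l + 1))"
    using gg by (intro mult_mono) auto
  also have "\<dots> = 10 * entropy a" by (simp add: entropy_def)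
  also have "\<dots> \<le> 10 * (c^2 * entropy a)" using c1 ent0 mult_right_mono[OF c1 ent0] by simp
  finally have 2: "(real (ngroups a) * ?g) * ewidth a \<le> 10 * (c^2 * entropy a)" .
  have "real (length (table a)) = 2 * (real (ngroups a) * K) + (real (ngroups a) * ?g) * ewidth a"
    by (simp add: length_table algebra_simps)
  with 1 2 show ?thesis by simp
qed

section \<open>Total space\<close>

lemma chars_nonempty: "chars \<noteq> {}"
  using length_ge_2 length_L by (auto simp: chars_def simp del: length_L)

definition total_entropy :: real where
  "total_entropy = (\<Sum>a\<in>chars. entropy a)"

lemma card_chars_log: "card chars * log 2 n \<le> total_entropy"
  unfolding total_entropy_def using sum_bounded_below[of chars "log 2 n" entropy] log_n_le_entropy by simp

lemma log_n_le_total: "log 2 n \<le> total_entropy"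
proof -
  have "1 \<le> card chars" using chars_nonempty by (simp add: Suc_le_eq card_gt_0_iff)
  hence "1 * log 2 n \<le> card chars * log 2 n" using log_n_nonneg by (intro mult_right_mono) auto
  with card_chars_log show ?thesis by simp
qed

text \<open>A top node thus serves at least \<open>w / 4\<close> characters, which keeps the top
  level linear in \<sigma>.\<close>

lemma w_le_br: "w \<le> 4 * (br * br)"
proof -
  have "w < (Suc br)^2" unfolding br_def by (rule Suc_floor_sqrt_power2_gt)
  also have "\<dots> \<le> (2 * br)^2" using br_pos by (intro power_mono) auto
  finally show ?thesis by (simp add: power2_eq_square)
qed

lemma length_cells_le:
  "real (length cells * w) \<le> 400 * (real c)^2 * (total_entropy + \<sigma>)"
proof -
  define X where "X = c^2 * total_entropy"
  have c1: "1 \<le> real c" using c_pos by simp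
  have cw: "real c * w \<le> X"
  proof -
    have "real c * w \<le> real c * (c * log 2 n)" using w_le_log by (intro mult_left_mono) auto
    also have "\<dots> = c^2 * log 2 n" by (simp add: power2_eq_square)
    also have "\<dots> \<le> X" unfolding X_def using log_n_le_total by (intro mult_left_mono) auto
    finally show ?thesis .
  qed
  have w: "real w \<le> X" using mult_right_mono[OF c1, of "real w"] cw by simp
  have K: "real K \<le> 16 * X" using cw by (simp add: K_def)
  have nK: "card chars * real K \<le> 16 * X"
  proof -
    have "card chars * real K \<le> card chars * (16 * c^2 * log 2 n)"
      using K_le_log by (intro mult_left_mono) auto
    also have "\<dots> = 16 * c^2 * (card chars * log 2 n)" by simp
    also have "\<dots> \<le> 16 * c^2 * total_entropy" using card_chars_log by (intro mult_left_mono) auto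
    finally show ?thesis by (simp add: X_def)
  qed
  have ns: "node_size \<le> 2 * K" using br_le(1) w_le_K by (simp add: node_size_def)
  have "card blocks * node_size \<le> card chars * (2 * K)"
    using ns card_blocks_le by (intro mult_mono) auto
  hence "real (card blocks * node_size) \<le> real (card chars * (2 * K))" by (simp only: of_nat_le_iff)
  hence blk: "real (card blocks * node_size) \<le> 32 * X" using nK by simp
  have "\<sigma> div (br * br) * node_size \<le> \<sigma> div (br * br) * (68 * c * (br * br))"
  proof (rule mult_le_mono2)
    have "K \<le> 16 * c * (4 * (br * br))" unfolding K_def using w_le_br by (rule mult_le_mono2)
    moreover have "1 * (br * br) \<le> c * (br * br)" using c_pos by (intro mult_le_mono1) simp
    ultimately show "node_size \<le> 68 * c * (br * br)"
      unfolding node_size_def mult.assoc mult_1 by linarith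
  qed
  also have "\<dots> = (\<sigma> div (br * br) * (br * br)) * (68 * c)" by simp
  also have "\<dots> \<le> \<sigma> * (68 * c)" by (intro mult_right_mono div_times_less_eq_dividend) simp
  finally have "real (\<sigma> div (br * br) * node_size) \<le> real (\<sigma> * (68 * c))" by (simp only: of_nat_le_iff)
  moreover have "real \<sigma> * (68 * c) \<le> 68 * (c^2 * real \<sigma>)"
    using mult_right_mono[OF c1, of "c * real \<sigma>"] by (simp add: power2_eq_square mult_ac)
  moreover have "real node_size \<le> 32 * X" using ns K by linarith
  moreover have "real (\<sigma> * (68 * c)) = real \<sigma> * (68 * c)" by simp
  moreover have "real (Suc (\<sigma> div (br * br)) * node_size) =
      node_size + real (\<sigma> div (br * br) * node_size)" by simp
  ultimately have top: "real (Suc (\<sigma> div (br * br)) * node_size) \<le> 32 * X + 68 * (c^2 * real \<sigma>)"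
    by linarith
  have "(\<Sum>a\<in>chars. real (length (table a))) \<le> (\<Sum>a\<in>chars. 170 * c^2 * entropy a)"
    by (intro sum_mono length_table_le)
  also have "\<dots> = 170 * X" by (simp add: X_def total_entropy_def sum_distrib_left mult.assoc)
  finally have tab: "real (\<Sum>a\<in>chars. length (table a)) \<le> 170 * X" by simp
  \<comment> \<open>379 = 1 + 80 + 32 + 32 + 64 + 170, for the field with \<open>w\<close>, the five
    further fields, the top nodes, the second-level nodes, the headers and the tables. The padding
    cells add 17 below.\<close>
  have "real (length bits) \<le> 379 * X + 68 * (c^2 * real \<sigma>)"
    using w K top blk nK tab
    unfolding length_bits addr4_def addr3_def addr2_def addr1_def by simp
  moreover have "length cells * w \<le> length bits + J * w"
    using div_times_less_eq_dividend[of "length bits" w] by (simp add: length_cells distrib_right)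
  hence "real (length cells * w) \<le> real (length bits + J * w)" by (simp only: of_nat_le_iff)
  moreover have "real (J * w) \<le> 17 * X" using cw w by (simp add: J_def distrib_right)
  moreover have "0 \<le> c^2 * real \<sigma>" by simp
  moreover have "0 \<le> X" using w by linarith
  moreover have "400 * (real c)^2 * (total_entropy + \<sigma>) = 400 * X + 400 * (c^2 * real \<sigma>)"
    by (simp add: X_def distrib_left)
  moreover have "real (length bits + J * w) = length bits + real (J * w)" by simp
  ultimately show ?thesis by linarith
qed

text \<open>Ensures \<open>log 2 \<sigma> \<ge> 1\<close>, so that a bare term \<open>r\<close> is
  absorbed by \<open>r * log 2 \<sigma>\<close>.\<close>

lemma sigma_ge_2: "2 \<le> \<sigma>"
proof -
  have "last T < T ! 0" using last_T_less[of 0] length_ge_2 by simp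
  moreover have "0 < n" using length_ge_2 by linarith
  hence "T ! 0 \<in> set T" by (rule nth_mem)
  hence "T ! 0 < \<sigma>" using valid unfolding valid_text_def by blast
  ultimately show ?thesis by simp
qed

text \<open>The tangents are taken at \<open>?r / ?s\<close>, the average number of runs per
  character of the alphabet. Their correction terms sum to at most 0, as no more than \<sigma>
  characters occur. The summands 1 of the entropies add up to \<open>?r\<close>, which accounts for
  the factor 2.\<close>

lemma total_entropy_le: "total_entropy \<le> 2 * (num_runs L * log 2 (n / num_runs L) + num_runs L * log 2 \<sigma>)"
proof -
  let ?r = "real (num_runs L)" and ?s = "real \<sigma>"
  have sum_r: "(\<Sum>a\<in>chars. real (r a)) = ?r"
    using sum_num_runs_of[of L] by (simp add: chars_def flip: of_nat_sum)
  have s: "2 \<le> ?s" using sigma_ge_2 by simp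
  note n = n_pos
  obtain a0 where a0: "a0 \<in> chars" using chars_nonempty by blast
  have "r a0 \<le> num_runs L"
    using member_le_sum[of a0 chars r] a0 sum_num_runs_of[of L] by (simp add: chars_def)
  hence r: "1 \<le> ?r" using r_bounds(1)[OF a0] by linarith
  have "num_runs L = card (fst ` runs L)" by (simp add: num_runs_def card_image[OF inj_on_fst_runs])
  also have "\<dots> \<le> card {..<n}"
    by (intro card_mono) (auto dest: runs_fst_less)
  finally have rn: "?r \<le> n" by simp
  have "(\<Sum>a\<in>chars. r a * log 2 (n / r a)) \<le>
      (\<Sum>a\<in>chars. r a * log 2 (n / (?r / ?s)) + (?r / ?s - r a) / ln 2)"
    using r_bounds(1) r s n by (intro sum_mono log_tangent) auto
  also have "\<dots> = ?r * log 2 (n / (?r / ?s)) + (card chars * (?r / ?s) - ?r) / ln 2"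
    by (simp add: sum.distrib sum_subtractf sum_r flip: sum_distrib_right sum_divide_distrib)
  also have "card chars * (?r / ?s) \<le> ?r"
  proof -
    have "card chars \<le> card {..<\<sigma>}" using set_L_subset by (intro card_mono) (auto simp: chars_def)
    hence "card chars * (?r / ?s) \<le> ?s * (?r / ?s)" using r s by (intro mult_right_mono) auto
    thus ?thesis using s by simp
  qed
  hence "?r * log 2 (n / (?r / ?s)) + (card chars * (?r / ?s) - ?r) / ln 2 \<le> ?r * log 2 (n / (?r / ?s))"
    by (simp add: divide_nonpos_pos)
  also have "log 2 (n / (?r / ?s)) = log 2 (n / ?r) + log 2 ?s"
    using n r s by (simp add: log_divide log_mult)
  finally have 1: "(\<Sum>a\<in>chars. r a * log 2 (n / r a)) \<le> ?r * log 2 (n / ?r) + ?r * log 2 ?s"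
    by (simp add: distrib_left)
  have "1 \<le> log 2 ?s" using s by (simp add: one_le_log_cancel_iff)
  hence 2: "?r \<le> ?r * log 2 ?s" using mult_left_mono[of 1 "log 2 ?s" ?r] r by simp
  have 3: "0 \<le> ?r * log 2 (n / ?r)" 
  proof (rule mult_nonneg_nonneg)
    show "0 \<le> log 2 (n / ?r)"
      using r rn n by (subst zero_le_log_cancel_iff) (auto simp: le_divide_eq)
  qed simp
  have "total_entropy = (\<Sum>a\<in>chars. r a * log 2 (n / r a)) + ?r"
    unfolding total_entropy_def entropy_def
    by (simp add: distrib_left sum.distrib sum_r)
  moreover have "S + ?r \<le> 2 * (x + y)" if "S \<le> x + y" "?r \<le> y" "0 \<le> x" for S x y :: real
    using that by simp
  ultimately show ?thesis using 1 2 3 by presburger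
qed

lemma space_le: "real (length cells * w) \<le> 800 * (real c)^2 * space_bound \<sigma> T"
proof -
  have "total_entropy + \<sigma> \<le> 2 * space_bound \<sigma> T"
    using total_entropy_le by (simp add: space_bound_def Let_def)
  hence "400 * (real c)^2 * (total_entropy + \<sigma>) \<le> 400 * (real c)^2 * (2 * space_bound \<sigma> T)"
    by (intro mult_left_mono) auto
  moreover have "400 * (real c)^2 * (2 * space_bound \<sigma> T) = 800 * (real c)^2 * space_bound \<sigma> T" by simp
  ultimately show ?thesis using length_cells_le by linarith
qed

text \<open>The left-hand side is the loop factor given to \<open>halts_query\<close>, one more than
  the bound on the halvings of the binary search.\<close>

lemma time_le: "real (floor_log (r a) + 5) \<le> 5 * time_bound a T"
proof (cases "r a = 0")
  case False
  hence "real (floor_log (r a)) \<le> log 2 (r a)" by (intro floor_log_le_log) simp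
  moreover have "0 \<le> log 2 (r a)" using False by simp
  moreover have "max (r a) 1 = r a" using False by simp
  ultimately show ?thesis unfolding time_bound_def by simp
qed (simp add: time_bound_def)

end

theorem theorem7:
  fixes c :: nat
  shows "\<exists>k \<ge> c. \<exists>(query :: com) (C :: real). \<forall>(\<sigma> :: nat) (T :: nat list) (w :: nat).
    valid_text \<sigma> T \<and> word_size_ok c w (length T) \<sigma> \<longrightarrow>
    (\<exists>D :: nat list.
      (\<forall>x \<in> set D. x < 2 ^ w) \<and>
      real (length D * w) \<le> C * space_bound \<sigma> T \<and>
      (\<forall>a < \<sigma>. \<forall>P :: nat list. \<exists>t R.
        exec w k query (D, query_input a (sa_interval T P)) t (D, R) \<and>
        query_output R = sa_interval T (a # P) \<and>
        real t \<le> C * time_bound a T))"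
proof -
  define query where "query = query_com (16 * c) (16 * c + 1)"
  \<comment> \<open>The first summand serves the space bound, the second the time bound.\<close>
  define C where "C = 800 * (real c)^2 + 5 * real (cost query)"
  have main: "\<exists>D :: nat list.
      (\<forall>x \<in> set D. x < 2 ^ w) \<and>
      real (length D * w) \<le> C * space_bound \<sigma> T \<and>
      (\<forall>a < \<sigma>. \<forall>P :: nat list. \<exists>t R.
        exec w (48 * c + 3) query (D, query_input a (sa_interval T P)) t (D, R) \<and>
        query_output R = sa_interval T (a # P) \<and>
        real t \<le> C * time_bound a T)"
    if valid: "valid_text \<sigma> T" and ws: "word_size_ok c w (length T) \<sigma>" for \<sigma> T w
  proof -
    \<comment> \<open>A positive word size of at most \<open>c * log 2 n\<close> rules out texts of
      length 1.\<close>
    have "0 < real w" "real w \<le> c * log 2 (length T)" using ws by (simp_all add: word_size_ok_def)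
    hence "0 < c * log 2 (length T)" by linarith
    hence "0 < log 2 (length T)" by (simp add: zero_less_mult_iff)
    moreover have "0 < length T" using valid by (simp add: valid_text_def)
    ultimately have "2 \<le> length T" by simp
    then interpret rlcsa \<sigma> T c w using valid ws by unfold_locales
    have space0: "0 \<le> space_bound \<sigma> T"
    proof -
      have "0 \<le> 800 * (real c)^2 * space_bound \<sigma> T" by (rule order_trans[OF _ space_le]) simp
      thus ?thesis using c_pos by (simp add: zero_le_mult_iff)
    qed
    have time0: "0 \<le> time_bound a T" for a
      using time_le[of a] by linarith
    have "\<exists>t R. exec w (48 * c + 3) query (cells, query_input a (sa_interval T P)) t (cells, R) \<and>
        query_output R = sa_interval T (a # P) \<and> real t \<le> C * time_bound a T" if "a < \<sigma>" for a P
    proof -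
      have "halts (floor_log (r a) + 5) (query_com (16 * c) J) (query_input a (sa_interval T P))
        (\<lambda>U'. query_output U' = sa_interval T (a # P))"
        using that by (intro halts_query) simp_all
      then obtain R t U' where e: "exec w wpr (query_com (16 * c) J)
          (cells, query_input a (sa_interval T P)) t (cells, R)"
        "t \<le> (floor_log (r a) + 5) * cost (query_com (16 * c) J)"
        "\<forall>x<100. R x = U' x" "query_output U' = sa_interval T (a # P)"
        unfolding halts_def by blast
      have q: "query_com (16 * c) J = query" "wpr = 48 * c + 3" by (simp_all add: query_def J_def wpr_def)
      have "real t \<le> real (floor_log (r a) + 5) * cost query"
        using e(2) unfolding q by (metis of_nat_le_iff of_nat_mult)
      hence "real t \<le> (5 * time_bound a T) * cost query"
        using mult_right_mono[OF time_le, of "real (cost query)" a] by linarith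
      moreover have "C * time_bound a T =
          800 * (real c)^2 * time_bound a T + (5 * time_bound a T) * cost query"
        by (simp add: C_def distrib_right)
      moreover have "0 \<le> 800 * (real c)^2 * time_bound a T" using time0 by (intro mult_nonneg_nonneg) auto
      ultimately have "real t \<le> C * time_bound a T" by linarith
      moreover have "query_output R = query_output U'" using e(3) by (simp add: query_output_def)
      ultimately show ?thesis using e(1,4) unfolding q by metis
    qed
    moreover have "800 * (real c)^2 * space_bound \<sigma> T \<le> C * space_bound \<sigma> T"
      using space0 by (intro mult_right_mono) (simp_all add: C_def)
    hence "real (length cells * w) \<le> C * space_bound \<sigma> T" using space_le by linarith
    ultimately show ?thesis using cells_less by blast
  qed
  show ?thesis
    by (rule exI[of _ "48 * c + 3"], rule conjI, simp, rule exI[of _ query], rule exI[of _ C])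
      (use main in blast)
qed


end
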